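(* Let $\mathbf{x}=(x_1,x_2)$ be such that $1=x_1>x_2\ge0$, let $q\in(0,1]$, and let $\boldsymbol{\alpha}=(\alpha_1,\alpha_2)\in(0,1)^2$ be such that $\alpha_1+\alpha_2=1$. Let $X\sim\alpha_1\Pi_{1-qx_1}+\alpha_2\Pi_{1-qx_2}$ and $n\ge3$, and let $\nu_n$ be the unique signed measure corresponding to $X([n])$. (a) Let $k\in\{3,\dots,n\}$. - If $\operatorname{Li}_{1-k}\bigl(-\alpha_1^{-1}(1-\alpha_1)\bigr)<0$, then $\nu_n([k])>0$ for $x_2$ sufficiently close to $1$. - If $\operatorname{Li}_{1-k}\bigl(-\alpha_1^{-1}(1-\alpha_1)\bigr)>0$, then $\nu_n([k])<0$ for $x_2$ sufficiently close to $1$. (If $\operatorname{Li}_{1-k}\bigl(-\alpha_1^{-1}(1-\alpha_1)\bigr)=0$, then the sign of $\nu_n([k])$ depends on which zero of $\operatorname{Li}_{1-k}$ one is considering.) (b) $\alpha_1\ge 1/(1-r_2^{(n)})$ if and only if $X([n])\in\mathcal{R}$ for $x_2$ sufficiently close to $1$.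
   Context: For a finite set $S$ and a $\sigma$-finite measure $\nu$ on $\mathcal{P}(S)\setminus\{\emptyset\}$ (where $\mathcal{P}(S)$ is the power set), let $Y^\nu=\{B_j\}_{j\in I}$ be the Poisson process on $\mathcal{P}(S)\setminus\{\emptyset\}$ with intensity measure $\nu$. Define $X^\nu=(X^\nu_i)_{i\in S}$ by $X^\nu_i=1$ if $i\in\bigcup_{j\in I}B_j$ and $X^\nu_i=0$ otherwise. $\mathcal{R}$ denotes the set of all $\{0,1\}$-valued processes $(X_i)_{i\in S}$ that are equal in distribution to $X^\nu$ for some $\nu$. Here $S=[n]=\{1,\dots,n\}$, $[k]=\{1,\dots,k\}$, and $X([n])=(X_1,\dots,X_n)$ is the restriction of $X=(X_j)_{j\in\mathbb{N}}$ to $[n]$. $\Pi_p$ denotes the product measure on $\{0,1\}^{\mathbb{N}}$ in which each coordinate equals $1$ with probability $p$. For any $n$, whether $X([n])$ belongs to $\mathcal{R}$ does not depend on $q\in(0,1]$. The signed measure $\nu_n$ corresponding to $X([n])$ is the unique signed measure on $\mathcal{P}([n])\setminus\{\emptyset\}$ satisfying $\nu_n(\{T\subseteq[n]:T\cap I\ne\emptyset\})=-\log P(X_i=0\text{ for all }i\in I)$ for all $I\subseteq[n]$; $\nu_n([k])$ denotes the mass it gives to the single set $[k]$. For $s\in\mathbb{R}$, $\operatorname{Li}_s$ is the polylogarithm with index $s$, $\operatorname{Li}_s(z)=\sum_{k\ge1}z^k/k^s$ for $|z|<1$, extended to all $z\in\mathbb{C}$ (except for poles) by analytic continuation; when $s$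 is a negative integer it is a rational function. For $n\ge2$, $\operatorname{Li}_{1-n}$ has exactly $n$ distinct non-positive roots $0=r_1^{(n)}>r_2^{(n)}>\dots>r_n^{(n)}=-\infty$ (with $-\infty$ counted as a root); thus for $n\ge3$, $r_2^{(n)}$ is the largest strictly negative root of $\operatorname{Li}_{1-n}$. *)

theory Defs
  imports "HOL-Probability.Probability" "HOL-Complex_Analysis.Complex_Analysis" "HOL-Library.Nonpos_Ints"
begin

text \<open>
  Processes with values in \<open>{0, 1}\<close> are represented by \<open>bool\<close>-valued functions, with
  \<open>True\<close> in the role of \<open>1\<close>. A process indexed by \<open>S\<close> is a function
  \<open>X :: 'i \<Rightarrow> 'w \<Rightarrow> bool\<close> of which only the coordinates in \<open>S\<close> matter. In particular,
  the law of the restriction of \<open>X\<close> to \<open>T\<close> is \<open>process_law M T X\<close>.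
\<close>

definition process_law :: "'w measure \<Rightarrow> 'i set \<Rightarrow> ('i \<Rightarrow> 'w \<Rightarrow> bool) \<Rightarrow> ('i \<Rightarrow> bool) measure" where
  "process_law M S X = distr M (\<Pi>\<^sub>M i\<in>S. count_space UNIV) (\<lambda>\<omega>. \<lambda>i\<in>S. X i \<omega>)"


section \<open>Poisson representable processes\<close>

text \<open>
  The random collection of points \<open>{B\<^sub>j}\<close> of the Poisson process is the random multiset \<open>Y\<close>; the
  number of points in \<open>A\<close> is \<open>points_in Y A\<close>. Collections with infinitely many points are
  not needed: below the ground space is finite and carries all its subsets as measurable sets, so
  that a \<open>\<sigma>\<close>-finite intensity measure is automatically finite. Writing out the Poisson probabilities
  (instead of using \<open>poisson_pmf\<close>) includes the parameter \<open>0\<close>.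
\<close>

definition points_in :: "('w \<Rightarrow> 'b multiset) \<Rightarrow> 'b set \<Rightarrow> 'w \<Rightarrow> nat" where
  "points_in Y A \<omega> = size {# B \<in># Y \<omega>. B \<in> A #}"

definition poisson_process :: "'w measure \<Rightarrow> 'b measure \<Rightarrow> ('w \<Rightarrow> 'b multiset) \<Rightarrow> bool" where
  "poisson_process P \<nu> Y \<longleftrightarrow>
     prob_space P \<and> finite_measure \<nu> \<and>
     (\<forall>\<omega>\<in>space P. set_mset (Y \<omega>) \<subseteq> space \<nu>) \<and>
     (\<forall>A\<in>sets \<nu>. points_in Y A \<in> P \<rightarrow>\<^sub>M count_space UNIV \<and>
        (\<forall>k. measure P {\<omega> \<in> space P. points_in Y A \<omega> = k} =
               measure \<nu> A ^ k / fact k * exp (- measure \<nu> A))) \<and>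
     (\<forall>F\<subseteq>sets \<nu>. finite F \<longrightarrow> disjoint F \<longrightarrow>
        prob_space.indep_vars P (\<lambda>_. count_space UNIV) (points_in Y) F)"

definition cover_process :: "('w \<Rightarrow> 'i set multiset) \<Rightarrow> 'i \<Rightarrow> 'w \<Rightarrow> bool" where
  "cover_process Y i \<omega> \<longleftrightarrow> i \<in> \<Union> (set_mset (Y \<omega>))"

text \<open>
  The set \<open>\<R>\<close> for a finite index set \<open>S\<close>, as the set of the laws of the processes \<open>X\<^sup>\<nu>\<close>; a process
  belongs to \<open>\<R>\<close> if its law does. The underlying probability space may be taken on the type
  of point configurations, since every Poisson process has a version there.
\<close>

definition poisson_representable_laws :: "'i set \<Rightarrow> ('i \<Rightarrow> bool) measure set" where
  "poisson_representable_laws S =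
     {process_law P S (cover_process Y) | \<nu> (P :: 'i set multiset measure) Y.
        sigma_finite_measure \<nu> \<and> space \<nu> = Pow S - {{}} \<and> sets \<nu> = Pow (Pow S - {{}}) \<and>
        poisson_process P \<nu> Y}"


section \<open>The signed measure corresponding to a process\<close>

text \<open>
  Signed measures are real-valued; extensionality removes the values outside of the
  \<open>\<sigma>\<close>-algebra, so that a signed measure is determined by its values on \<open>\<Sigma>\<close>.
\<close>

definition signed_measure_on :: "'b set set \<Rightarrow> ('b set \<Rightarrow> real) \<Rightarrow> bool" where
  "signed_measure_on \<Sigma> \<nu> \<longleftrightarrow> \<nu> \<in> extensional \<Sigma> \<and>
     (\<forall>A :: nat \<Rightarrow> 'b set. range A \<subseteq> \<Sigma> \<longrightarrow> disjoint_family A \<longrightarrow> (\<Union>i. A i) \<in> \<Sigma> \<longrightarrow>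
        (\<lambda>i. \<nu> (A i)) sums \<nu> (\<Union>i. A i))"

definition corresponds_to ::
    "'i set \<Rightarrow> 'w measure \<Rightarrow> ('i \<Rightarrow> 'w \<Rightarrow> bool) \<Rightarrow> ('i set set \<Rightarrow> real) \<Rightarrow> bool" where
  "corresponds_to S M X \<nu> \<longleftrightarrow>
     signed_measure_on (Pow (Pow S - {{}})) \<nu> \<and>
     (\<forall>I\<subseteq>S. \<nu> {T. T \<subseteq> S \<and> T \<inter> I \<noteq> {}} =
        - ln (measure M {\<omega> \<in> space M. \<forall>i\<in>I. \<not> X i \<omega>}))"

definition signed_measure_of ::
    "'i set \<Rightarrow> 'w measure \<Rightarrow> ('i \<Rightarrow> 'w \<Rightarrow> bool) \<Rightarrow> 'i set set \<Rightarrow> real" where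
  "signed_measure_of S M X = (THE \<nu>. corresponds_to S M X \<nu>)"

lemma signed_measure_on_empty:
  assumes "signed_measure_on \<Sigma> \<nu>" "{} \<in> \<Sigma>"
  shows "\<nu> {} = 0"
proof -
  have "(\<lambda>i::nat. \<nu> {}) sums \<nu> {}"
    using assms unfolding signed_measure_on_def
    by (auto dest!: spec[where x = "\<lambda>_. {}"] simp: disjoint_family_on_def)
  then have "(\<lambda>i::nat. \<nu> {}) \<longlonglongrightarrow> 0"
    by (intro summable_LIMSEQ_zero sums_summable)
  then show ?thesis
    by (simp add: LIMSEQ_const_iff)
qed

lemma signed_measure_on_eq_sum:
  assumes \<nu>: "signed_measure_on (Pow E) \<nu>" and "finite A" "A \<subseteq> E"
  shows "\<nu> A = (\<Sum>T\<in>A. \<nu> {T})"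
  using assms(2,3)
proof (induction A rule: finite_induct)
  case empty
  then show ?case using signed_measure_on_empty[OF \<nu>] by simp
next
  case (insert T A)
  have "(\<lambda>i. \<nu> (binaryset {T} A i)) sums \<nu> (\<Union>i. binaryset {T} A i)"
  proof -
    have "disjoint_family (binaryset {T} A)"
      using insert.hyps by (auto simp: disjoint_family_on_def binaryset_def)
    moreover have "range (binaryset {T} A) \<subseteq> Pow E" "(\<Union>i. binaryset {T} A i) \<in> Pow E"
      using insert.prems by (auto simp: binaryset_def)
    ultimately show ?thesis
      using \<nu> unfolding signed_measure_on_def by blast
  qed
  moreover have "(\<lambda>i. \<nu> (binaryset {T} A i)) sums (\<nu> {T} + \<nu> A)"
    by (rule binaryset_sums) (use signed_measure_on_empty[OF \<nu>] in simp)
  ultimately have "\<nu> (insert T A) = \<nu> {T} + \<nu> A"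
    using sums_unique2 by (fastforce simp: UN_binaryset_eq)
  then show ?case using insert by simp
qed

lemma signed_measure_on_sum:
  assumes "finite E"
  shows "signed_measure_on (Pow E) (restrict (\<lambda>A. \<Sum>T\<in>A. w T) (Pow E))"
  unfolding signed_measure_on_def
proof (intro conjI allI impI)
  fix A :: "nat \<Rightarrow> 'a set"
  assume A: "range A \<subseteq> Pow E" "disjoint_family A" "(\<Union>i. A i) \<in> Pow E"
  have *: "(\<Sum>T\<in>B. w T) = (\<Sum>T\<in>E. if T \<in> B then w T else 0)" if "B \<subseteq> E" for B
    using that assms by (intro sum.mono_neutral_cong_left) auto
  have "(\<lambda>i. if T \<in> A i then w T else 0) sums (if T \<in> (\<Union>i. A i) then w T else 0)" for T
  proof (cases "T \<in> (\<Union>i. A i)")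
    case True
    then obtain j where j: "T \<in> A j" by blast
    then have "T \<in> A i \<longleftrightarrow> i = j" for i
      using A(2) by (auto simp: disjoint_family_on_def)
    then show ?thesis
      using True sums_single[of j "\<lambda>_. w T"] by simp
  next
    case False
    then show ?thesis by auto
  qed
  then have "(\<lambda>i. \<Sum>T\<in>E. if T \<in> A i then w T else 0) sums
      (\<Sum>T\<in>E. if T \<in> (\<Union>i. A i) then w T else 0)"
    by (intro sums_sum) auto
  moreover have "A i \<subseteq> E" for i
    using A(1) by auto
  ultimately show "(\<lambda>i. restrict (\<lambda>A. \<Sum>T\<in>A. w T) (Pow E) (A i)) sums
      restrict (\<lambda>A. \<Sum>T\<in>A. w T) (Pow E) (\<Union>i. A i)"
    using A(3) by (simp add: *)
qed auto

lemma ex1_signed_measure_hitting: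
  fixes g :: "'i set \<Rightarrow> real"
  assumes "finite S" "g {} = 0"
  shows "\<exists>!\<nu>. signed_measure_on (Pow (Pow S - {{}})) \<nu> \<and>
           (\<forall>I\<subseteq>S. \<nu> {T. T \<subseteq> S \<and> T \<inter> I \<noteq> {}} = g I)"
proof -
  let ?E = "Pow S - {{}}"
  let ?hit = "\<lambda>I. {T. T \<subseteq> S \<and> T \<inter> I \<noteq> {}}"
  have finE: "finite ?E" using assms by simp
  have split: "(\<Sum>T\<in>?E. w T) = (\<Sum>T\<in>?hit I. w T) + (\<Sum>T\<in>Pow (S - I) - {{}}. w T)"
    if "I \<subseteq> S" for I and w :: "'i set \<Rightarrow> real"
  proof -
    have "?E = ?hit I \<union> (Pow (S - I) - {{}})" using that by blast
    moreover have "?hit I \<inter> (Pow (S - I) - {{}}) = {}" by blast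
    moreover have "finite (?hit I)" "finite (Pow (S - I) - {{}})" using assms by auto
    ultimately show ?thesis by (simp add: sum.union_disjoint)
  qed
  show ?thesis
  proof (rule ex_ex1I)
    define h where "h J = g S - g (S - J)" for J
    define w where "w T = (-1) ^ card T * (\<Sum>U\<in>Pow T. (-1) ^ card U * h U)" for T
    have h: "h J = (\<Sum>T\<in>Pow J. w T)" if "finite J" for J
      unfolding w_def
      by (subst inclusion_exclusion_symmetric[OF refl that, of h])
        (simp add: sum_distrib_left)
    have "w {} = 0" by (simp add: w_def h_def)
    then have h': "h J = (\<Sum>T\<in>Pow J - {{}}. w T)" if "finite J" for J
      using h[OF that] that by (simp add: sum_diff1)
    have "(\<Sum>T\<in>?hit I. w T) = g I" if "I \<subseteq> S" for I
    proof -
      have "finite (S - I)" "S - (S - I) = I" using assms that by auto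
      then show ?thesis
        using split[OF that, of w] h'[of S] h'[of "S - I"] assms
        by (simp add: h_def)
    qed
    then show "\<exists>\<nu>. signed_measure_on (Pow ?E) \<nu> \<and> (\<forall>I\<subseteq>S. \<nu> (?hit I) = g I)"
      using signed_measure_on_sum[OF finE, of w]
      by (intro exI[of _ "restrict (\<lambda>A. \<Sum>T\<in>A. w T) (Pow ?E)"]) auto
  next
    fix \<nu> \<nu>'
    assume \<nu>: "signed_measure_on (Pow ?E) \<nu> \<and> (\<forall>I\<subseteq>S. \<nu> (?hit I) = g I)"
      and \<nu>': "signed_measure_on (Pow ?E) \<nu>' \<and> (\<forall>I\<subseteq>S. \<nu>' (?hit I) = g I)"
    have sum: "\<nu> A = (\<Sum>T\<in>A. \<nu> {T})" "\<nu>' A = (\<Sum>T\<in>A. \<nu>' {T})" if "A \<subseteq> ?E" for A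
      using \<nu> \<nu>' that finite_subset[OF that finE] signed_measure_on_eq_sum by blast+
    define d where "d T = \<nu> {T} - \<nu>' {T}" for T
    have "(\<Sum>T\<in>?hit I. d T) = 0" if "I \<subseteq> S" for I
    proof -
      have "?hit I \<subseteq> ?E" by blast
      then show ?thesis
        using sum[of "?hit I"] \<nu> \<nu>' that by (simp add: d_def sum_subtractf)
    qed
    note hit0 = this
    have "?hit S = ?E" by blast
    have J0: "(\<Sum>T\<in>Pow J - {{}}. d T) = 0" if "J \<subseteq> S" for J
    proof -
      have "S - (S - J) = J" using that by blast
      then show ?thesis
        using split[of "S - J" d] hit0[of "S - J"] hit0[of S] \<open>?hit S = ?E\<close> by simp
    qed
    have d0: "d J = 0" if "J \<in> ?E" for J
    proof -
      have "finite J" using that assms finite_subset by blast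
      then show ?thesis using that
      proof (induction J rule: finite_psubset_induct)
        case (psubset J)
        have "d T = 0" if "T \<in> (Pow J - {{}}) - {J}" for T
          using that psubset by blast
        then have "(\<Sum>T\<in>Pow J - {{}}. d T) = d J"
          using psubset by (subst sum.remove[of _ J]) auto
        then show ?case using J0[of J] psubset.prems by simp
      qed
    qed
    show "\<nu> = \<nu>'"
    proof
      fix A
      show "\<nu> A = \<nu>' A"
      proof (cases "A \<subseteq> ?E")
        case True
        then show ?thesis
          using sum[OF True] d0 by (auto simp: d_def intro!: sum.cong)
      next
        case False
        then have "A \<notin> Pow ?E" by blast
        then show ?thesis
          using \<nu> \<nu>' unfolding signed_measure_on_def by (metis extensional_arb)
      qed
    qed
  qed
qed

lemma ex1_corresponds_to:
  assumes "finite S" "prob_space M"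
  shows "\<exists>!\<nu>. corresponds_to S M X \<nu>"
  unfolding corresponds_to_def using assms
  by (intro ex1_signed_measure_hitting) (simp_all add: prob_space.prob_space)

lemma corresponds_to_signed_measure_of:
  assumes "finite S" "prob_space M"
  shows "corresponds_to S M X (signed_measure_of S M X)"
  unfolding signed_measure_of_def by (rule theI'[OF ex1_corresponds_to[OF assms]])


section \<open>Mixtures of product measures\<close>

definition bernoulli_product :: "real \<Rightarrow> (nat \<Rightarrow> bool) measure" where
  "bernoulli_product p = (\<Pi>\<^sub>M i\<in>{1..}. measure_pmf (bernoulli_pmf p))"

definition mixture :: "real \<Rightarrow> 'b measure \<Rightarrow> real \<Rightarrow> 'b measure \<Rightarrow> 'b measure" where
  "mixture a P b Q =
     measure_of (space P) (sets P) (\<lambda>A. ennreal a * emeasure P A + ennreal b * emeasure Q A)"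

lemma
  shows space_mixture [simp]: "space (mixture a P b Q) = space P"
    and sets_mixture [simp, measurable_cong]: "sets (mixture a P b Q) = sets P"
  by (simp_all add: mixture_def)

lemma emeasure_mixture:
  assumes "sets P = sets Q" "A \<in> sets P"
  shows "emeasure (mixture a P b Q) A = ennreal a * emeasure P A + ennreal b * emeasure Q A"
  unfolding mixture_def
proof (rule emeasure_measure_of_sigma)
  show "countably_additive (sets P) (\<lambda>A. ennreal a * emeasure P A + ennreal b * emeasure Q A)"
  proof (rule countably_additiveI)
    fix A :: "nat \<Rightarrow> 'a set"
    assume "range A \<subseteq> sets P" "disjoint_family A"
    then show "(\<Sum>i. ennreal a * emeasure P (A i) + ennreal b * emeasure Q (A i)) =
        ennreal a * emeasure P (\<Union>i. A i) + ennreal b * emeasure Q (\<Union>i. A i)"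
      using assms(1) by (simp add: suminf_add[symmetric] suminf_emeasure)
  qed
next
  show "sigma_algebra (space P) (sets P)" ..
qed (use assms in \<open>auto simp: positive_def\<close>)


section \<open>Polylogarithms\<close>

text \<open>
  For \<open>s = 0, -1, -2, \<dots>\<close> the function \<open>Li\<^sub>s\<close> is rational with its only pole at \<open>1\<close>; for all other
  \<open>s\<close> the point \<open>1\<close> is a branch point, and the principal branch has a cut along \<open>[1, \<infinity>)\<close>. The domain
  is connected, so the continuation is unique. At a point outside of the domain, \<open>polylog\<close>
  is unspecified.
\<close>

definition polylog_domain :: "real \<Rightarrow> complex set" where
  "polylog_domain s = (if s \<in> \<int>\<^sub>\<le>\<^sub>0 then - {1} else - {of_real x | x. 1 \<le> x})"

definition polylog :: "real \<Rightarrow> complex \<Rightarrow> complex" where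
  "polylog s z = (THE w. \<exists>f. f holomorphic_on polylog_domain s \<and>
     (\<forall>u\<in>ball 0 1. f u = (\<Sum>k. u ^ Suc k / of_nat (Suc k) powr of_real s)) \<and> w = f z)"

text \<open>
  The root \<open>r\<^sub>2\<^sup>(\<^sup>n\<^sup>)\<close>, which exists for \<open>n \<ge> 3\<close>.
\<close>

definition largest_negative_root :: "nat \<Rightarrow> real" where
  "largest_negative_root n = (GREATEST r. r < 0 \<and> polylog (1 - real n) (of_real r) = 0)"

end

theory Submission
  imports Defs
begin

text \<open>
  Put \<open>\<alpha> = \<alpha>\<^sub>2\<close>, \<open>\<epsilon> = - ln x\<^sub>2\<close> and \<open>\<phi>(t) = ln (1 - \<alpha> + \<alpha> e\<^sup>t)\<close>. Inverting the hitting
  probabilities shows that \<open>\<nu>\<^sub>n\<close> gives a set of size \<open>k \<ge> 2\<close> the \<open>k\<close>-th finite difference of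
  \<open>y \<mapsto> \<phi>(\<epsilon> (y - n))\<close>, which by the mean value theorem is \<open>\<epsilon>\<^sup>k \<phi>\<^sup>(\<^sup>k\<^sup>)(t)\<close> for some
  \<open>t \<in> [- n \<epsilon>, 0]\<close>. Since \<open>\<phi>\<^sup>(\<^sup>k\<^sup>)(t) = - Li\<^sub>1\<^sub>-\<^sub>k(- \<alpha> e\<^sup>t / (1 - \<alpha>))\<close>, the sign of the
  polylogarithm at \<open>- \<alpha> / (1 - \<alpha>)\<close> decides.

  In the coordinate \<open>p = z / (z - 1)\<close> the functions \<open>- Li\<^sub>1\<^sub>-\<^sub>k\<close> become polynomials \<open>P\<^sub>k\<close> of degree
  \<open>k\<close> with \<open>P\<^sub>k\<^sub>+\<^sub>1 = p (1 - p) P\<^sub>k'\<close>, so by Rolle's theorem all their roots lie in \<open>[0, 1]\<close> and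
  interlace. Thus the smallest positive root \<open>s\<^sub>k\<close> decreases in \<open>k\<close>, and \<open>P\<^sub>k\<^sub>+\<^sub>1 < 0\<close> on
  \<open>(s\<^sub>k\<^sub>+\<^sub>1, s\<^sub>k]\<close>: below \<open>s\<^sub>n\<close> all of \<open>P\<^sub>2, \<dots>, P\<^sub>n\<close> are nonnegative, beyond it one of them is
  negative. Finally \<open>X([n])\<close> is representable iff \<open>\<nu>\<^sub>n\<close> is a nonnegative measure.
\<close>


section \<open>Polylogarithms of nonpositive integer index\<close>

text \<open>With \<open>w = z / (z - 1)\<close> one has \<open>z dw/dz = w (1 - w)\<close>. Hence \<open>Li\<^sub>-\<^sub>m(z)\<close>, which
  arises from \<open>Li\<^sub>0(z) = - w\<close> by applying \<open>z d/dz\<close> \<open>m\<close> times, is \<open>- logistic_poly m w\<close>.\<close>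

primrec logistic_poly :: "nat \<Rightarrow> 'a :: field_char_0 poly" where
  "logistic_poly 0 = [:0, 1:]"
| "logistic_poly (Suc m) = [:0, 1, -1:] * pderiv (logistic_poly m)"

lemma degree_logistic_poly: "degree (logistic_poly m :: 'a :: field_char_0 poly) = Suc m"
proof (induction m)
  case (Suc m)
  have "pderiv (logistic_poly m :: 'a poly) \<noteq> 0"
    using Suc by (auto simp: pderiv_eq_0_iff)
  then show ?case
    using Suc by (simp add: degree_mult_eq degree_pderiv del: mult_pCons_left)
qed simp

lemma poly_logistic_poly_Suc:
  "poly (logistic_poly (Suc m)) x = x * (1 - x) * poly (pderiv (logistic_poly m)) x"
  by (simp add: algebra_simps)

text \<open>The recursion has integer coefficients, so it commutes with the embedding of the reals.
  This ties the complex polylogarithm to real polynomials, whose signs and roots can be studied by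
  calculus.\<close>

lemma logistic_poly_map_of_real:
  "map_poly of_real (logistic_poly m :: real poly) = (logistic_poly m :: 'a :: real_field poly)"
proof (induction m)
  case (Suc m)
  have "map_poly of_real ([:0, 1, -1:] * pderiv p) = [:0, 1, -1:] * pderiv (map_poly of_real p :: 'a poly)"
    for p :: "real poly"
    by (rule poly_eqI) (simp add: coeff_map_poly coeff_pCons coeff_pderiv split: nat.splits)
  then show ?case
    using Suc by simp
qed (simp add: map_poly_pCons)

lemma poly_logistic_poly_of_real:
  "poly (logistic_poly m) (of_real x :: 'a :: real_field) = of_real (poly (logistic_poly m) x)"
proof -
  have "poly (map_poly of_real p) (of_real x :: 'a) = of_real (poly p x)" for p :: "real poly"
    by (induction p) (auto simp: map_poly_pCons)
  then show ?thesis
    by (metis logistic_poly_map_of_real)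
qed

lemma logistic_poly_0 [simp]: "poly (logistic_poly m) 0 = 0"
  by (cases m) auto

section \<open>Real roots and signs of the logistic polynomials\<close>

text \<open>Rolle's theorem gives \<open>m\<close> roots of the derivative, which has degree \<open>m\<close>, so there are no others.\<close>

lemma pderiv_roots_interlace:
  fixes p :: "real poly" and a :: "nat \<Rightarrow> real"
  assumes deg: "degree p = Suc m" and mono: "strict_mono_on {..m} a"
    and root: "\<And>i. i \<le> m \<Longrightarrow> poly p (a i) = 0"
  obtains b where "\<And>i. i < m \<Longrightarrow> a i < b i \<and> b i < a (Suc i)"
    and "strict_mono_on {..<m} b" and "{x. poly (pderiv p) x = 0} = b ` {..<m}"
proof -
  have "\<exists>y. a i < y \<and> y < a (Suc i) \<and> poly (pderiv p) y = 0" if "i < m" for i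
  proof -
    have "a i < a (Suc i)"
      using that by (intro strict_mono_onD[OF mono]) auto
    then obtain y where "a i < y" "y < a (Suc i)"
        "poly p (a (Suc i)) - poly p (a i) = (a (Suc i) - a i) * poly (pderiv p) y"
      using poly_MVT by blast
    then show ?thesis
      using root[of i] root[of "Suc i"] that by auto
  qed
  then obtain b where b: "a i < b i \<and> b i < a (Suc i)" "poly (pderiv p) (b i) = 0" if "i < m" for i
    by metis
  have mono_b: "strict_mono_on {..<m} b"
  proof (rule strict_mono_onI)
    fix i j assume ij: "i \<in> {..<m}" "j \<in> {..<m}" "i < j"
    then have "a (Suc i) \<le> a j"
      by (intro monotone_onD[OF strict_mono_on_imp_mono_on[OF mono]]) auto
    then show "b i < b j"
      using b(1)[of i] b(1)[of j] ij by auto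
  qed
  have "pderiv p \<noteq> 0"
    using deg by (auto simp: pderiv_eq_0_iff)
  then have "finite {x. poly (pderiv p) x = 0}" "card {x. poly (pderiv p) x = 0} \<le> m"
    using poly_roots_finite card_poly_roots_bound[of "pderiv p"] deg by (auto simp: degree_pderiv)
  moreover have "card (b ` {..<m}) = m"
    using strict_mono_on_imp_inj_on[OF mono_b] by (simp add: card_image)
  ultimately have "b ` {..<m} = {x. poly (pderiv p) x = 0}"
    using b(2) by (intro card_seteq) auto
  then show ?thesis
    by (intro that[of b] b(1) mono_b) auto
qed

text \<open>Intermediate value theorem; it spreads a sign found at one mean value point over a whole
  root-free interval.\<close>

lemma poly_no_root_same_sgn:
  fixes p :: "real poly"
  assumes "\<And>x. x \<in> {a..b} \<Longrightarrow> poly p x \<noteq> 0" and "x \<in> {a..b}" "y \<in> {a..b}"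
  shows "poly p x > 0 \<longleftrightarrow> poly p y > 0"
proof -
  have "poly p u > 0" if "u \<in> {a..b}" "v \<in> {a..b}" "poly p v > 0" for u v
  proof (rule ccontr)
    assume "\<not> poly p u > 0"
    then have "0 \<in> closed_segment (poly p v) (poly p u)"
      using that by (auto simp: closed_segment_eq_real_ivl)
    moreover have "continuous_on (closed_segment v u) (poly p)"
      by (intro continuous_intros)
    ultimately obtain z where "z \<in> closed_segment v u" "poly p z = 0"
      using ivt_decreasing_component_on_1[of v u "poly p" 0]
      by (metis IVT'_closed_segment_real)
    then show False
      using that assms(1) by (auto simp: closed_segment_eq_real_ivl split: if_splits)
  qed
  then show ?thesis
    using assms by blast
qed

text \<open>Induction on m: the factor \<open>x * (1 - x)\<close> contributes the roots 0 and 1, and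
  the m roots of the derivative separate the old roots. The clauses over all j are carried along
  because representability involves the masses of all sizes up to n.\<close>

lemma logistic_poly_roots:
  assumes "1 \<le> m"
  shows "\<exists>a. strict_mono_on {..m} a \<and> a 0 = 0 \<and> a m = 1 \<and>
      {x. poly (logistic_poly m) x = (0::real)} = a ` {..m} \<and>
      (\<forall>x. 0 < x \<and> x < a 1 \<longrightarrow> poly (logistic_poly m) x > 0) \<and>
      (\<forall>j\<in>{1..m}. \<forall>x\<in>{0..a 1}. poly (logistic_poly j) x \<ge> 0) \<and>
      (\<forall>x. a 1 < x \<and> x < 1 \<longrightarrow> (\<exists>j\<in>{2..m}. poly (logistic_poly j) x < 0))"
  using assms
proof (induction m rule: dec_induct)
  case base
  have eq: "poly (logistic_poly (Suc 0)) x = x * (1 - x)" for x :: real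
    by (simp add: pderiv_pCons algebra_simps)
  show ?case
    unfolding One_nat_def eq
    \<comment> \<open>For m = 1 the roots are 0 and 1, so \<open>a 1 = 1\<close> and the clause on
      \<open>a 1 < x < 1\<close> is vacuous.\<close>
    by (intro exI[of _ "\<lambda>i. real i"]) (auto simp: strict_mono_on_def atMost_Suc pderiv_pCons algebra_simps
        mult_left_le)
next
  case (step m)
  define p :: "real poly" where "p = logistic_poly m"
  from step.IH obtain a where a: "strict_mono_on {..m} a" "a 0 = 0" "a m = 1"
      "{x. poly p x = 0} = a ` {..m}"
      and pos: "\<And>x. 0 < x \<Longrightarrow> x < a 1 \<Longrightarrow> poly p x > 0"
      and nonneg: "\<And>j x. j \<in> {1..m} \<Longrightarrow> x \<in> {0..a 1} \<Longrightarrow> poly (logistic_poly j) x \<ge> 0"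
      and neg: "\<And>x. a 1 < x \<Longrightarrow> x < 1 \<Longrightarrow> \<exists>j\<in>{2..m}. poly (logistic_poly j) x < 0"
    unfolding p_def by metis
  have root: "poly p (a i) = 0" if "i \<le> m" for i
    using a(4) that by blast
  obtain b where b: "\<And>i. i < m \<Longrightarrow> a i < b i \<and> b i < a (Suc i)" "strict_mono_on {..<m} b"
      "{x. poly (pderiv p) x = 0} = b ` {..<m}"
    using pderiv_roots_interlace[OF degree_logistic_poly a(1)[unfolded p_def]] root
    unfolding p_def by metis
  have "0 < m" using step.hyps by simp
  have b0: "0 < b 0" "b 0 < a 1"
    using b(1)[OF \<open>0 < m\<close>] a(2) by auto
  have a1: "a 1 \<le> 1"
    using monotone_onD[OF strict_mono_on_imp_mono_on[OF a(1)], of 1 m] \<open>0 < m\<close> a(3) by auto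
  \<comment> \<open>A critical point \<open>b i\<close> with i \<ge> 1 exceeds \<open>a i\<close>,
    hence \<open>a 1\<close>; so \<open>b 0\<close> is the only one up to
    \<open>a 1\<close>.\<close>
  have pderiv_root: "x = b 0" if "poly (pderiv p) x = 0" "x \<le> a 1" for x
  proof -
    have "x \<in> b ` {..<m}"
      using that b(3) by blast
    then obtain i where i: "i < m" "x = b i"
      by blast
    have "i = 0"
    proof (rule ccontr)
      assume "i \<noteq> 0"
      then have "a 1 \<le> a i"
        using i by (intro monotone_onD[OF strict_mono_on_imp_mono_on[OF a(1)]]) auto
      then show False
        using i b(1)[of i] that by auto
    qed
    then show ?thesis using i by simp
  qed
  \<comment> \<open>\<open>p\<close> rises from 0 at 0 to a positive value at \<open>b 0\<close>, so
    its derivative is positive somewhere in between, and no critical point below \<open>b 0\<close>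
    can change that sign.\<close>
  have pderiv_pos: "0 < y" if "0 < x" "x < b 0" "y = poly (pderiv p) x" for x y
  proof -
    obtain z where z: "0 < z" "z < b 0" "poly p (b 0) - poly p 0 = (b 0 - 0) * poly (pderiv p) z"
      using poly_MVT[OF b0(1)] by blast
    have "poly (pderiv p) z > 0"
      using z pos[OF b0] b0 root[of 0] a(2) by (simp add: zero_less_mult_iff)
    moreover have "poly (pderiv p) u \<noteq> 0" if "u \<in> {min x z..max x z}" for u
    proof -
      have "u < b 0"
        using that \<open>x < b 0\<close> z(2) by auto
      then show ?thesis
        using pderiv_root[of u] b0 by auto
    qed
    ultimately show ?thesis
      using poly_no_root_same_sgn[of "min x z" "max x z" "pderiv p" x z] that by auto
  qed
  \<comment> \<open>Likewise \<open>p\<close> falls from a positive value at \<open>b 0\<close> to 0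
    at \<open>a 1\<close>. The endpoint \<open>a 1\<close> is included because no polynomial of
    lower index is negative there.\<close>
  have pderiv_neg: "poly (pderiv p) x < 0" if "b 0 < x" "x \<le> a 1" for x
  proof -
    obtain z where z: "b 0 < z" "z < a 1"
        "poly p (a 1) - poly p (b 0) = (a 1 - b 0) * poly (pderiv p) z"
      using poly_MVT[OF b0(2)] by blast
    have "(a 1 - b 0) * poly (pderiv p) z < 0"
      using z(3) pos[OF b0] root[of 1] \<open>0 < m\<close> by simp
    then have "poly (pderiv p) z < 0"
      using b0 by (simp add: mult_less_0_iff)
    moreover have nz: "poly (pderiv p) u \<noteq> 0" if "u \<in> {min x z..max x z}" for u
    proof -
      have "b 0 < u" "u \<le> a 1"
        using that \<open>b 0 < x\<close> \<open>x \<le> a 1\<close> z(1,2) by auto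
      then show ?thesis
        using pderiv_root[of u] by auto
    qed
    ultimately have "\<not> poly (pderiv p) x > 0"
      using poly_no_root_same_sgn[of "min x z" "max x z" "pderiv p" x z] by auto
    then show ?thesis
      using nz[of x] by auto
  qed
  \<comment> \<open>The critical points, shifted by one place, between the outer roots 0 and
    1.\<close>
  define a' where "a' i = (if i = 0 then 0 else if i = Suc m then 1 else b (i - 1))" for i
  have b_range: "0 < b i \<and> b i < 1" if "i < m" for i
  proof -
    have "a 0 \<le> a i" "a (Suc i) \<le> a m"
      using that by (auto intro!: monotone_onD[OF strict_mono_on_imp_mono_on[OF a(1)]])
    then show ?thesis
      using b(1)[OF that] a(2,3) by simp
  qed
  have mono': "strict_mono_on {..Suc m} a'"
  proof (rule strict_mono_onI)
    fix i j assume "i \<in> {..Suc m}" "j \<in> {..Suc m}" "i < j"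
    then show "a' i < a' j"
      using b_range[of "i - 1"] b_range[of "j - 1"] strict_mono_onD[OF b(2), of "i - 1" "j - 1"]
      by (auto simp: a'_def)
  qed
  have a'1: "a' 1 = b 0"
    using \<open>0 < m\<close> by (simp add: a'_def)
  have roots': "{x. poly (logistic_poly (Suc m)) x = (0::real)} = a' ` {..Suc m}"
  proof -
    have "{x. poly (logistic_poly (Suc m)) x = (0::real)} = {0, 1} \<union> b ` {..<m}"
      using b(3) unfolding poly_logistic_poly_Suc p_def by auto
    also have "b ` {..<m} = a' ` Suc ` {..<m}"
      unfolding image_image by (intro image_cong) (auto simp: a'_def)
    also have "{0, 1} \<union> a' ` Suc ` {..<m} = a' ` ({0, Suc m} \<union> Suc ` {..<m})"
    proof -
      have "a' 0 = 0" "a' (Suc m) = 1"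
        by (simp_all add: a'_def)
      then show ?thesis
        by (simp add: image_Un)
    qed
    also have "{0, Suc m} \<union> Suc ` {..<m} = {..Suc m}"
      by (auto simp: image_Suc_lessThan)
    finally show ?thesis .
  qed
  have pos': "poly (logistic_poly (Suc m)) x > 0" if "0 < x" "x < b 0" for x :: real
    using pderiv_pos[OF that refl] that b0 a1 by (simp add: poly_logistic_poly_Suc p_def
        del: logistic_poly.simps)
  have nonneg': "poly (logistic_poly j) x \<ge> 0" if "j \<in> {1..Suc m}" "x \<in> {0..b 0}" for j and x :: real
  proof (cases "j = Suc m")
    case True
    have "b 0 \<in> {x. poly (logistic_poly (Suc m)) x = 0}"
      unfolding roots' using a'1 by (intro image_eqI[of _ _ 1]) auto
    then have "poly (logistic_poly (Suc m)) (b 0) = 0"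
      by simp
    then show ?thesis
      using pos'[of x] that True by (cases "x = 0 \<or> x = b 0") (auto simp del: logistic_poly.simps)
  qed (use nonneg[of j x] that b0 in auto)
  \<comment> \<open>Up to \<open>a 1\<close> the new polynomial is negative; beyond
    \<open>a 1\<close> the induction hypothesis supplies a smaller index.\<close>
  have neg': "\<exists>j\<in>{2..Suc m}. poly (logistic_poly j) x < 0" if "b 0 < x" "x < 1" for x :: real
  proof (cases "x \<le> a 1")
    case True
    then have "poly (logistic_poly (Suc m)) x < 0"
      using pderiv_neg[OF that(1)] that b0
      by (simp add: poly_logistic_poly_Suc p_def mult_less_0_iff zero_less_mult_iff
          del: logistic_poly.simps)
    then show ?thesis
      using \<open>0 < m\<close> by (intro bexI[of _ "Suc m"]) auto
  qed (use neg[of x] that in force)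
  have "a' 0 = 0" "a' (Suc m) = 1"
    by (simp_all add: a'_def)
  then show ?case
    using mono' roots' pos' nonneg' neg' unfolding a'1[symmetric]
    by (intro exI[of _ a'] conjI) blast+
qed

text \<open>The right-hand side is holomorphic off 1 and has the defining power series on the unit
  disc. The punctured plane is connected, so by the identity theorem it is the only continuation,
  which settles the definite description.\<close>

lemma polylog_neg_eq:
  assumes "z \<noteq> 1"
  shows "polylog (- real m) z = - poly (logistic_poly m) (z / (z - 1))"
proof -
  define f where "f m z = - poly (logistic_poly m) (z / (z - 1))" for m and z :: complex
  have deriv: "(f m has_field_derivative
      poly (pderiv (logistic_poly m)) (z / (z - 1)) / (z - 1)\<^sup>2) (at z)" if "z \<noteq> 1" for m z
    unfolding f_def using that
    by (auto intro!: derivative_eq_intros simp: field_simps power2_eq_square)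
  have f_Suc: "f (Suc m) z = z * (poly (pderiv (logistic_poly m)) (z / (z - 1)) / (z - 1)\<^sup>2)"
    if "z \<noteq> 1" for m z
  proof -
    have "z / (z - 1) * (1 - z / (z - 1)) = - (z / (z - 1)\<^sup>2)"
      using that by (simp add: field_simps power2_eq_square)
    then show ?thesis
      unfolding f_def poly_logistic_poly_Suc by simp
  qed
  \<comment> \<open>The constant coefficient is set apart because \<open>0 ^ 0 = 1\<close>, whereas
    the series of the polylogarithm starts at k = 1.\<close>
  define c where "c m k = (if k = 0 then 0 else of_nat k ^ m :: complex)" for m k :: nat
  have sums: "(\<lambda>k. c m k * z ^ k) sums f m z" if "norm z < 1" for m z
    using that
  proof (induction m arbitrary: z)
    case 0
    have "z \<noteq> 1" using 0 by auto
    have "(\<lambda>k. z * z ^ k) sums (z * (1 / (1 - z)))"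
      using geometric_sums[OF 0] by (rule sums_mult)
    then have "(\<lambda>k. c 0 (Suc k) * z ^ Suc k) sums (f 0 z - c 0 0 * z ^ 0)"
      using \<open>z \<noteq> 1\<close> by (simp add: c_def f_def minus_divide_right)
    then show ?case
      by (subst (asm) sums_Suc_iff) simp
  next
    case (Suc m)
    have "z \<noteq> 1" using Suc by auto
    \<comment> \<open>Differentiating and then multiplying by z multiplies the k-th coefficient by
      k, which turns \<open>c m\<close> into \<open>c (Suc m)\<close>.\<close>
    have "(\<lambda>k. diffs (c m) k * z ^ k) sums
        (poly (pderiv (logistic_poly m)) (z / (z - 1)) / (z - 1)\<^sup>2)"
      by (rule termdiffs_sums_strong[OF Suc.IH deriv[OF \<open>z \<noteq> 1\<close>] Suc.prems])
    then have "(\<lambda>k. z * (diffs (c m) k * z ^ k)) sums f (Suc m) z"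
      unfolding f_Suc[OF \<open>z \<noteq> 1\<close>] by (rule sums_mult)
    then have "(\<lambda>k. c (Suc m) (Suc k) * z ^ Suc k) sums (f (Suc m) z - c (Suc m) 0 * z ^ 0)"
      by (simp add: c_def diffs_def algebra_simps)
    then show ?case
      by (subst (asm) sums_Suc_iff) simp
  qed
  have dom: "polylog_domain (- real m) = - {1}"
    by (simp add: polylog_domain_def)
  have coeff: "u ^ Suc k / of_nat (Suc k) powr of_real (- real m) = c m (Suc k) * u ^ Suc k"
    for u :: complex and k
    by (simp add: c_def powr_minus field_simps del: of_nat_Suc)
  have series: "f m u = (\<Sum>k. u ^ Suc k / of_nat (Suc k) powr of_real (- real m))"
    if "norm u < 1" for u
  proof -
    have "(\<lambda>k. c m (Suc k) * u ^ Suc k) sums (f m u - c m 0 * u ^ 0)"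
      using sums[OF that] by (subst sums_Suc_iff) simp
    then show ?thesis
      unfolding coeff by (simp add: c_def sums_iff)
  qed
  have holo: "f m holomorphic_on - {1}"
    using deriv by (auto simp: holomorphic_on_def field_differentiable_def
        intro: has_field_derivative_at_within)
  show ?thesis
    unfolding polylog_def dom f_def[symmetric]
  proof (rule the_equality)
    show "\<exists>g. g holomorphic_on - {1} \<and>
        (\<forall>u\<in>ball 0 1. g u = (\<Sum>k. u ^ Suc k / of_nat (Suc k) powr of_real (- real m))) \<and>
        f m z = g z"
      using holo series by (intro exI[of _ "f m"]) (auto simp: dist_norm)
  next
    fix w
    assume "\<exists>g. g holomorphic_on - {1} \<and>
        (\<forall>u\<in>ball 0 1. g u = (\<Sum>k. u ^ Suc k / of_nat (Suc k) powr of_real (- real m))) \<and>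
        w = g z"
    then obtain g where g: "g holomorphic_on - {1}"
      "\<And>u. norm u < 1 \<Longrightarrow> g u = (\<Sum>k. u ^ Suc k / of_nat (Suc k) powr of_real (- real m))"
      "w = g z"
      by (auto simp: dist_norm)
    have "g z = f m z"
    proof (rule analytic_continuation_open[where f = g and g = "f m" and s = "ball 0 1" and s' = "- {1}"])
      show "connected (- {1::complex})"
        by (rule connected_punctured_universe) simp
    qed (use assms g(1,2) holo series in \<open>auto simp: dist_norm\<close>)
    then show "w = f m z"
      using g by simp
  qed
qed

lemma polylog_neg_of_real:
  assumes "z \<noteq> 1"
  shows "polylog (- real m) (of_real z) = of_real (- poly (logistic_poly m) (z / (z - 1)))"
proof -
  have "complex_of_real z / (complex_of_real z - 1) = of_real (z / (z - 1))"
    by simp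
  then show ?thesis
    using assms by (simp add: polylog_neg_eq poly_logistic_poly_of_real del: of_real_divide of_real_diff)
qed

text \<open>The map \<open>z / (z - 1)\<close> sends the negative reals decreasingly onto (0, 1),
  with inverse \<open>- s / (1 - s)\<close>. So the largest negative root corresponds to the
  smallest root in (0, 1).\<close>

lemma largest_negative_root_eq:
  assumes "0 < s" "s < 1" "poly (logistic_poly m) s = 0"
    and "\<And>x. 0 < x \<Longrightarrow> x < s \<Longrightarrow> poly (logistic_poly m) x > 0"
  shows "largest_negative_root (Suc m) = - s / (1 - s)"
  unfolding largest_negative_root_def
proof (rule Greatest_equality)
  define r where "r = - s / (1 - s)"
  have "r / (r - 1) = s" "r < 0"
    using assms by (simp_all add: r_def field_simps)
  then have "r < 0 \<and> polylog (1 - real (Suc m)) (of_real r) = 0"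
    using assms polylog_neg_of_real[of r m] by simp
  then show "- s / (1 - s) < 0 \<and> polylog (1 - real (Suc m)) (of_real (- s / (1 - s))) = 0"
    unfolding r_def .
next
  fix r assume r: "r < 0 \<and> polylog (1 - real (Suc m)) (of_real r) = 0"
  then have "poly (logistic_poly m) (r / (r - 1)) = 0"
    using polylog_neg_of_real[of r m] by simp
  moreover have "0 < r / (r - 1)"
    using r by (simp add: field_simps)
  ultimately have "s \<le> r / (r - 1)"
    using assms(4)[of "r / (r - 1)"] by fastforce
  then show "r \<le> - s / (1 - s)"
    using r assms by (simp add: field_simps)
qed


section \<open>Finite differences and the signed measure of a mixture\<close>

primrec fwd_diff :: "nat \<Rightarrow> (real \<Rightarrow> real) \<Rightarrow> real \<Rightarrow> real" where
  "fwd_diff 0 F y = F y"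
| "fwd_diff (Suc k) F y = fwd_diff k F (y + 1) - fwd_diff k F y"

lemma fwd_diff_const_0 [simp]: "fwd_diff k (\<lambda>_. 0) y = 0"
  by (induction k arbitrary: y) auto

lemma fwd_diff_has_derivative:
  assumes "\<And>y. (F has_real_derivative F' y) (at y)"
  shows "(fwd_diff k F has_real_derivative fwd_diff k F' y) (at y)"
proof (induction k arbitrary: y)
  case 0
  have "fwd_diff 0 F = F" by auto
  then show ?case using assms by simp
next
  case (Suc k)
  have "fwd_diff (Suc k) F = (\<lambda>y. fwd_diff k F (y + 1) - fwd_diff k F y)" by auto
  moreover have "((\<lambda>y. fwd_diff k F (y + 1)) has_real_derivative fwd_diff k F' (y + 1)) (at y)"
    using Suc[of "y + 1"] by (simp add: DERIV_shift)
  ultimately show ?case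
    using Suc[of y] by (auto intro!: DERIV_diff)
qed

text \<open>Differences commute with derivatives, so each use of the mean value theorem trades one
  difference for one derivative and moves the point by at most 1.\<close>

lemma fwd_diff_mean_value:
  assumes "\<And>j y. (G j has_real_derivative G (Suc j) y) (at y)"
  shows "\<exists>\<xi>\<in>{y..y + real k}. fwd_diff k (G 0) y = G k \<xi>"
  using assms
proof (induction k arbitrary: G y)
  case (Suc k)
  obtain \<eta> where \<eta>: "y < \<eta>" "\<eta> < y + 1"
      "fwd_diff k (G 0) (y + 1) - fwd_diff k (G 0) y = (y + 1 - y) * fwd_diff k (G (Suc 0)) \<eta>"
    using MVT2[of y "y + 1" "fwd_diff k (G 0)" "fwd_diff k (G (Suc 0))"]
      fwd_diff_has_derivative[OF Suc.prems] by auto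
  moreover obtain \<xi> where "\<xi> \<in> {\<eta>..\<eta> + real k}" "fwd_diff k (G (Suc 0)) \<eta> = G (Suc k) \<xi>"
    using Suc.IH[of "\<lambda>j. G (Suc j)" \<eta>] Suc.prems by auto
  ultimately show ?case
    by (intro bexI[of _ \<xi>]) auto
qed auto

text \<open>Induction on B: the sets containing a new element b are all sets minus those missing b.
  Letting b be optional moves it into A, which raises the argument of F by 1; hence A stays
  general.\<close>

lemma sum_interval_eq_fwd_diff:
  fixes w :: "'i set \<Rightarrow> real"
  assumes F: "\<And>A. A \<subseteq> S \<Longrightarrow> (\<Sum>T\<in>Pow A. w T) = F (real (card A))"
    and "finite S" "A \<union> B \<subseteq> S" "A \<inter> B = {}"
  shows "(\<Sum>T | B \<subseteq> T \<and> T \<subseteq> A \<union> B. w T) = fwd_diff (card B) F (real (card A))"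
proof -
  have "finite B"
    using assms finite_subset by blast
  then show ?thesis
    using assms(3,4)
  proof (induction B arbitrary: A rule: finite_induct)
    case empty
    then show ?case using F[of A] by (simp add: Pow_def)
  next
    case (insert b B)
    have "finite A" "b \<notin> A"
      using insert.prems \<open>finite S\<close> finite_subset by auto
    have "(\<Sum>T | B \<subseteq> T \<and> T \<subseteq> insert b A \<union> B. w T) =
        (\<Sum>T | B \<subseteq> T \<and> T \<subseteq> A \<union> B. w T) + (\<Sum>T | insert b B \<subseteq> T \<and> T \<subseteq> A \<union> insert b B. w T)"
    proof (subst sum.union_disjoint[symmetric])
      have "finite (Pow (insert b A \<union> B))"
        using \<open>finite A\<close> insert.hyps by simp
      then show "finite {T. B \<subseteq> T \<and> T \<subseteq> A \<union> B}" "finite {T. insert b B \<subseteq> T \<and> T \<subseteq> A \<union> insert b B}"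
        by (auto elim!: finite_subset[rotated])
      show "{T. B \<subseteq> T \<and> T \<subseteq> A \<union> B} \<inter> {T. insert b B \<subseteq> T \<and> T \<subseteq> A \<union> insert b B} = {}"
        using \<open>b \<notin> A\<close> insert.hyps by auto
      show "(\<Sum>T | B \<subseteq> T \<and> T \<subseteq> insert b A \<union> B. w T) =
          sum w ({T. B \<subseteq> T \<and> T \<subseteq> A \<union> B} \<union> {T. insert b B \<subseteq> T \<and> T \<subseteq> A \<union> insert b B})"
        by (intro sum.cong) auto
    qed
    moreover have "insert b A \<union> B \<subseteq> S" "insert b A \<inter> B = {}" "A \<union> B \<subseteq> S" "A \<inter> B = {}"
      using insert.prems insert.hyps by auto
    ultimately show ?case
      using insert.IH[of "insert b A"] insert.IH[of A] insert.hyps \<open>finite A\<close> \<open>b \<notin> A\<close>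
      by (simp add: add.commute)
  qed
qed

text \<open>Moebius inversion for sums depending only on cardinality. With F = 0 it is also a
  uniqueness statement, and it serves in that form to compare laws.\<close>

lemma moebius_fwd_diff:
  fixes w :: "'i set \<Rightarrow> real"
  assumes "\<And>A. A \<subseteq> S \<Longrightarrow> (\<Sum>T\<in>Pow A. w T) = F (real (card A))"
    and "finite S" "B \<subseteq> S"
  shows "w B = fwd_diff (card B) F 0"
proof -
  have "{T. B \<subseteq> T \<and> T \<subseteq> {} \<union> B} = {B}" by auto
  then show ?thesis
    using sum_interval_eq_fwd_diff[OF assms(1,2), of "{}" B] assms(3) by simp
qed

text \<open>The probability that m given coordinates all vanish: each is 0 with probability q under
  the first component and q x under the second, whose weight is \<alpha>.\<close>

definition mixture_avoid :: "real \<Rightarrow> real \<Rightarrow> real \<Rightarrow> nat \<Rightarrow> real" where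
  "mixture_avoid \<alpha> q x m = (1 - \<alpha>) * q ^ m + \<alpha> * (q * x) ^ m"

text \<open>The function interpolates \<open>a \<mapsto> \<nu>(Pow A - {{}})\<close> with \<open>a = card A\<close> to real arguments.\<close>

definition log_avoid :: "real \<Rightarrow> real \<Rightarrow> real \<Rightarrow> nat \<Rightarrow> real \<Rightarrow> real" where
  "log_avoid \<alpha> q x n y =
     (real n - y) * ln q + ln (1 - \<alpha> + \<alpha> * exp (- ln x * (y - real n)))
       - ln (mixture_avoid \<alpha> q x n)"

text \<open>The value of the signed measure on any single set of k \<ge> 1 elements. The base point
  0 is the size of the empty set, to which k elements are added.\<close>

definition mass :: "real \<Rightarrow> real \<Rightarrow> real \<Rightarrow> nat \<Rightarrow> nat \<Rightarrow> real" where
  "mass \<alpha> q x n k = fwd_diff k (log_avoid \<alpha> q x n) 0"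

lemma mixture_avoid_pos:
  assumes "0 < \<alpha>" "\<alpha> < 1" "0 < q" "0 < x"
  shows "mixture_avoid \<alpha> q x m > 0"
  unfolding mixture_avoid_def using assms by (intro add_pos_pos mult_pos_pos) auto

text \<open>Pulling out the factor \<open>q ^ (n - a)\<close> leaves q only in a term affine in a,
  so differences of order at least 2 do not depend on q.\<close>

lemma ln_mixture_avoid:
  assumes "0 < \<alpha>" "\<alpha> < 1" "0 < q" "0 < x" "a \<le> n"
  shows "ln (mixture_avoid \<alpha> q x (n - a)) - ln (mixture_avoid \<alpha> q x n) = log_avoid \<alpha> q x n (real a)"
proof -
  have "x ^ (n - a) = exp (- ln x * (real a - real n))"
    using assms by (simp add: exp_of_nat_mult[symmetric] of_nat_diff powr_def powr_realpow[symmetric]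
        algebra_simps)
  then have "mixture_avoid \<alpha> q x (n - a) =
      q ^ (n - a) * (1 - \<alpha> + \<alpha> * exp (- ln x * (real a - real n)))"
    by (simp add: mixture_avoid_def power_mult_distrib algebra_simps)
  moreover have "1 - \<alpha> + \<alpha> * exp (- ln x * (real a - real n)) > 0"
    using assms by (intro add_pos_pos mult_pos_pos) auto
  ultimately show ?thesis
    using assms by (simp add: log_avoid_def ln_mult ln_realpow of_nat_diff)
qed

text \<open>With \<open>p(t) = \<alpha> e\<^sup>t / (1 - \<alpha> + \<alpha> e\<^sup>t)\<close> one has \<open>p' = p (1 - p)\<close>, so the derivatives of
  \<open>ln (1 - \<alpha> + \<alpha> e\<^sup>t)\<close> are polynomials in \<open>p\<close>.\<close>

lemma mass_mean_value:
  assumes "0 < \<alpha>" "\<alpha> < 1" "0 < x" "x < 1" "1 \<le> k" "k \<le> n"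
  obtains p where "\<alpha> * x ^ n / (1 - \<alpha> + \<alpha> * x ^ n) \<le> p" "p \<le> \<alpha>"
    and "mass \<alpha> q x n k = (- ln x) ^ k * poly (logistic_poly (k - 1)) p - (if k = 1 then ln q else 0)"
proof -
  define \<epsilon> where "\<epsilon> = - ln x"
  have "\<epsilon> > 0" using assms by (simp add: \<epsilon>_def)
  define D where "D y = 1 - \<alpha> + \<alpha> * exp (\<epsilon> * (y - real n))" for y
  have D_pos: "D y > 0" for y
    unfolding D_def using assms by (intro add_pos_pos mult_pos_pos) auto
  define p where "p y = \<alpha> * exp (\<epsilon> * (y - real n)) / D y" for y
  have D_deriv: "(D has_real_derivative \<epsilon> * (\<alpha> * exp (\<epsilon> * (y - real n)))) (at y)" for y
    unfolding D_def by (auto intro!: derivative_eq_intros)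
  have p_eq: "p y = 1 - (1 - \<alpha>) / D y" for y
  proof -
    have "\<alpha> * exp (\<epsilon> * (y - real n)) = D y - (1 - \<alpha>)"
      by (simp add: D_def)
    then show ?thesis
      using D_pos[of y] by (simp add: p_def diff_divide_distrib)
  qed
  have p_deriv: "(p has_real_derivative \<epsilon> * (p y * (1 - p y))) (at y)" for y
  proof -
    have "(p has_real_derivative (1 - \<alpha>) * (\<epsilon> * (\<alpha> * exp (\<epsilon> * (y - real n)))) / (D y)\<^sup>2) (at y)"
      unfolding p_eq using D_pos[of y]
      by (auto intro!: derivative_eq_intros D_deriv simp: power2_eq_square)
    moreover have "1 - p y = (1 - \<alpha>) / D y"
      by (simp add: p_eq)
    ultimately show ?thesis
      by (simp add: p_def power2_eq_square mult_ac)
  qed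
  \<comment> \<open>The j-th derivative of \<open>log_avoid\<close>. The term
    \<open>(n - y) * ln q\<close> survives one differentiation only, whence the correction at j = 1;
    the index \<open>j - 1\<close> occurs because the first derivative of the logarithm is already
    \<open>p\<close>, up to the factor \<epsilon>.\<close>
  define G where "G j y = (if j = 0 then log_avoid \<alpha> q x n y
      else \<epsilon> ^ j * poly (logistic_poly (j - 1)) (p y) - (if j = 1 then ln q else 0))" for j y
  have "(G j has_real_derivative G (Suc j) y) (at y)" for j y
  proof (cases j)
    case 0
    have "(log_avoid \<alpha> q x n has_real_derivative - ln q + \<epsilon> * (\<alpha> * exp (\<epsilon> * (y - real n))) / D y) (at y)"
      unfolding log_avoid_def \<epsilon>_def[symmetric] D_def[symmetric] using D_pos[of y]
      by (auto intro!: derivative_eq_intros D_deriv)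
    moreover have "G 0 = log_avoid \<alpha> q x n" by (auto simp: G_def)
    ultimately show ?thesis
      by (simp add: 0 G_def p_def)
  next
    case (Suc i)
    have "(G (Suc i) has_real_derivative
        \<epsilon> ^ Suc i * (poly (pderiv (logistic_poly i)) (p y) * (\<epsilon> * (p y * (1 - p y))))) (at y)"
      unfolding G_def by (auto intro!: derivative_eq_intros p_deriv simp del: logistic_poly.simps)
    then show ?thesis
      by (simp add: Suc G_def poly_logistic_poly_Suc mult_ac del: logistic_poly.simps)
  qed
  then obtain \<xi> where \<xi>: "0 \<le> \<xi>" "\<xi> \<le> real k" "fwd_diff k (G 0) 0 = G k \<xi>"
    using fwd_diff_mean_value[of G 0 k] by auto
  \<comment> \<open>By monotonicity the value at \<xi> in [0, n] lies between \<open>p 0\<close> and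
    \<open>p n = \<alpha>\<close>, the bounds claimed.\<close>
  have p_mono: "p y \<le> p z" if "y \<le> z" for y z
  proof -
    have "D y \<le> D z"
      using that assms \<open>\<epsilon> > 0\<close> by (simp add: D_def)
    then show ?thesis
      using D_pos[of y] assms by (simp add: p_eq frac_le)
  qed
  have "exp (\<epsilon> * (0 - real n)) = x ^ n"
    using assms by (simp add: \<epsilon>_def exp_of_nat2_mult)
  then have "p 0 = \<alpha> * x ^ n / (1 - \<alpha> + \<alpha> * x ^ n)"
    by (simp add: p_def D_def)
  moreover have "p (real n) = \<alpha>"
    by (simp add: p_def D_def)
  moreover have "G 0 = log_avoid \<alpha> q x n"
    by (auto simp: G_def)
  ultimately show ?thesis
    using that[of "p \<xi>"] p_mono[of 0 \<xi>] p_mono[of \<xi> "real n"] \<xi> assms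
    by (auto simp: mass_def G_def \<epsilon>_def)
qed

text \<open>The intermediate point always lies in [0, \<alpha>], so this holds for every x in (0,
  1), without a limit. At k = 1 the extra term \<open>- ln q\<close> is nonnegative since q \<le>
  1.\<close>

lemma mass_nonneg:
  assumes "0 < \<alpha>" "\<alpha> < 1" "0 < q" "q \<le> 1" "0 < x" "x < 1" "1 \<le> k" "k \<le> n"
    and "\<And>p. 0 \<le> p \<Longrightarrow> p \<le> \<alpha> \<Longrightarrow> poly (logistic_poly (k - 1)) p \<ge> 0"
  shows "mass \<alpha> q x n k \<ge> 0"
proof -
  obtain p where p: "\<alpha> * x ^ n / (1 - \<alpha> + \<alpha> * x ^ n) \<le> p" "p \<le> \<alpha>"
    "mass \<alpha> q x n k = (- ln x) ^ k * poly (logistic_poly (k - 1)) p - (if k = 1 then ln q else 0)"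
    using mass_mean_value assms by metis
  have "0 \<le> \<alpha> * x ^ n / (1 - \<alpha> + \<alpha> * x ^ n)"
    using assms by simp
  then have "poly (logistic_poly (k - 1)) p \<ge> 0"
    using assms(9) p by simp
  then have "(- ln x) ^ k * poly (logistic_poly (k - 1)) p \<ge> 0"
    using assms by (intro mult_nonneg_nonneg zero_le_power) auto
  moreover have "(if k = 1 then ln q else 0) \<le> 0"
    using assms by simp
  ultimately show ?thesis
    unfolding p(3) by linarith
qed

text \<open>As x tends to 1 both bounds on the intermediate point approach \<alpha>, and the sign of
  a polynomial is locally constant off its roots. For k \<ge> 2 the term with \<open>ln q\<close> is
  absent and the factor \<open>(- ln x) ^ k\<close> is positive.\<close>

lemma eventually_sgn_mass:
  assumes "0 < \<alpha>" "\<alpha> < 1" "2 \<le> k" "k \<le> n" "poly (logistic_poly (k - 1)) \<alpha> \<noteq> 0"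
  shows "\<forall>\<^sub>F x in at_left 1. sgn (mass \<alpha> q x n k) = sgn (poly (logistic_poly (k - 1)) \<alpha>)"
proof -
  define f where "f = poly (logistic_poly (k - 1) :: real poly)"
  have cont: "isCont f y" for y
    unfolding f_def by simp
  have "((\<lambda>y. sgn (f y)) \<longlongrightarrow> sgn (f \<alpha>)) (at \<alpha>)"
    using assms(5) cont[of \<alpha>] unfolding f_def[symmetric] isCont_def by (intro tendsto_sgn)
  then have "\<forall>\<^sub>F y in at \<alpha>. dist (sgn (f y)) (sgn (f \<alpha>)) < 1"
    by (rule tendstoD) simp
  then obtain d where d: "d > 0" "\<And>y. y \<noteq> \<alpha> \<Longrightarrow> dist y \<alpha> < d \<Longrightarrow> dist (sgn (f y)) (sgn (f \<alpha>)) < 1"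
    unfolding eventually_at by auto
  \<comment> \<open>Signs are -1, 0 or 1, and \<alpha> has a nonzero one; signs less than 1 apart
    agree.\<close>
  have sgn_eq: "sgn (f y) = sgn (f \<alpha>)" if "dist y \<alpha> < d" for y
    using d(2)[of y] that assms(5) f_def by (cases "y = \<alpha>") (auto simp: sgn_if dist_real_def split: if_splits)
  have "1 - \<alpha> + \<alpha> * 1 ^ n \<noteq> 0" by simp
  then have "((\<lambda>x. \<alpha> * x ^ n / (1 - \<alpha> + \<alpha> * x ^ n)) \<longlongrightarrow> \<alpha> * 1 ^ n / (1 - \<alpha> + \<alpha> * 1 ^ n)) (at_left 1)"
    by (intro tendsto_intros)
  then have "\<forall>\<^sub>F x in at_left 1. \<alpha> * x ^ n / (1 - \<alpha> + \<alpha> * x ^ n) > \<alpha> - d"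
    using d(1) by (intro order_tendstoD(1)) auto
  moreover have "\<forall>\<^sub>F x in at_left (1::real). x \<in> {0<..<1}"
    by (rule eventually_at_left_real) simp
  ultimately show ?thesis
  proof eventually_elim
    case (elim x)
    then obtain p where p: "\<alpha> * x ^ n / (1 - \<alpha> + \<alpha> * x ^ n) \<le> p" "p \<le> \<alpha>"
      "mass \<alpha> q x n k = (- ln x) ^ k * f p"
      using mass_mean_value[of \<alpha> x k n q] assms unfolding f_def by auto
    have "sgn (f p) = sgn (f \<alpha>)"
      using elim p d(1) by (intro sgn_eq) (auto simp: dist_real_def)
    moreover have "(- ln x) ^ k > 0"
      using elim by auto
    ultimately show ?case
      unfolding p(3) sgn_mult f_def[symmetric] by (simp only: sgn_pos mult_1)
  qed
qed

text \<open>The subsets of A are those not hitting \<open>S - A\<close>, so the hitting sums give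
  the sums over \<open>Pow A\<close>, and Moebius inversion recovers the weights. It applies both to
  the signed measure and to the intensity of a representing Poisson process.\<close>

lemma avoid_weights_eq_mass:
  fixes w :: "'i set \<Rightarrow> real"
  assumes "0 < \<alpha>" "\<alpha> < 1" "0 < q" "0 < x" "finite S"
    and hit: "\<And>I. I \<subseteq> S \<Longrightarrow>
      (\<Sum>T | T \<subseteq> S \<and> T \<inter> I \<noteq> {}. w T) = - ln (mixture_avoid \<alpha> q x (card I))"
    and B: "B \<subseteq> S" "B \<noteq> {}"
  shows "w B = mass \<alpha> q x (card S) (card B)"
proof -
  \<comment> \<open>Hitting sums never see the empty set, so its weight has to be fixed at 0 before
    inverting.\<close>
  define w' where "w' T = (if T = {} then 0 else w T)" for T
  have "(\<Sum>T\<in>Pow A. w' T) = log_avoid \<alpha> q x (card S) (real (card A))" if A: "A \<subseteq> S" for A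
  proof -
    have fin: "finite (Pow S)" using assms by simp
    have "(\<Sum>T | T \<subseteq> S \<and> T \<inter> S \<noteq> {}. w T) = (\<Sum>T\<in>Pow S. w' T)"
      using fin by (intro sum.mono_neutral_cong_left) (auto simp: w'_def)
    also have "\<dots> = (\<Sum>T\<in>Pow S - Pow A. w' T) + (\<Sum>T\<in>Pow A. w' T)"
      using fin A by (intro sum.subset_diff) auto
    also have "(\<Sum>T\<in>Pow S - Pow A. w' T) = (\<Sum>T | T \<subseteq> S \<and> T \<inter> (S - A) \<noteq> {}. w T)"
      by (intro sum.cong) (auto simp: w'_def)
    finally show ?thesis
      using hit[of S] hit[of "S - A"] ln_mixture_avoid[of \<alpha> q x "card A" "card S"] assms A
      by (simp add: card_mono card_Diff_subset finite_subset)
  qed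
  from moebius_fwd_diff[OF this \<open>finite S\<close> B(1)] show ?thesis
    using B by (simp add: w'_def mass_def)
qed


section \<open>Poisson representability\<close>

lemma avoid_event_in_sets:
  assumes "I \<subseteq> S" "finite I"
  shows "{f \<in> space (\<Pi>\<^sub>M i\<in>S. count_space UNIV). \<forall>i\<in>I. \<not> f i} \<in> sets (\<Pi>\<^sub>M i\<in>S. count_space UNIV)"
proof (rule sets.sets_Collect_finite_All)
  fix i assume "i \<in> I"
  then have [measurable]: "(\<lambda>f. f i) \<in> (\<Pi>\<^sub>M i\<in>S. count_space UNIV) \<rightarrow>\<^sub>M count_space (UNIV :: bool set)"
    using assms by (intro measurable_component_singleton) auto
  show "{f \<in> space (\<Pi>\<^sub>M i\<in>S. count_space UNIV). \<not> f i} \<in> sets (\<Pi>\<^sub>M i\<in>S. count_space UNIV)"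
    by measurable
qed fact

lemma measure_process_law_avoid:
  assumes "prob_space M" and X: "\<And>i. i \<in> S \<Longrightarrow> X i \<in> M \<rightarrow>\<^sub>M count_space UNIV"
    and "I \<subseteq> S" "finite I"
  shows "measure (process_law M S X) {f \<in> space (\<Pi>\<^sub>M i\<in>S. count_space UNIV). \<forall>i\<in>I. \<not> f i} =
    measure M {\<omega> \<in> space M. \<forall>i\<in>I. \<not> X i \<omega>}"
proof -
  have meas: "(\<lambda>\<omega>. \<lambda>i\<in>S. X i \<omega>) \<in> M \<rightarrow>\<^sub>M (\<Pi>\<^sub>M i\<in>S. count_space UNIV)"
    using X by (rule measurable_restrict)
  have "{f \<in> space (\<Pi>\<^sub>M i\<in>S. count_space UNIV). \<forall>i\<in>I. \<not> f i} \<in> sets (\<Pi>\<^sub>M i\<in>S. count_space UNIV)"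
    using assms by (intro avoid_event_in_sets)
  then have "measure (process_law M S X) {f \<in> space (\<Pi>\<^sub>M i\<in>S. count_space UNIV). \<forall>i\<in>I. \<not> f i} =
      measure M ((\<lambda>\<omega>. \<lambda>i\<in>S. X i \<omega>) -` {f \<in> space (\<Pi>\<^sub>M i\<in>S. count_space UNIV). \<forall>i\<in>I. \<not> f i} \<inter> space M)"
    unfolding process_law_def by (rule measure_distr[OF meas])
  also have "(\<lambda>\<omega>. \<lambda>i\<in>S. X i \<omega>) -` {f \<in> space (\<Pi>\<^sub>M i\<in>S. count_space UNIV). \<forall>i\<in>I. \<not> f i} \<inter> space M =
      {\<omega> \<in> space M. \<forall>i\<in>I. \<not> X i \<omega>}"
    using assms(3) by (auto simp: space_PiM)
  finally show ?thesis .
qed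

text \<open>Vanishing on \<open>S - A\<close> means that the set of ones lies in A, so avoidance
  probabilities are sums of point masses over subsets of A; Moebius inversion of the difference of
  the two laws makes all point masses agree.\<close>

lemma law_eqI_avoid:
  fixes L L' :: "('i \<Rightarrow> bool) measure"
  assumes S: "finite S" and fin: "finite_measure L" "finite_measure L'"
    and sets: "sets L = sets (\<Pi>\<^sub>M i\<in>S. count_space UNIV)" "sets L' = sets (\<Pi>\<^sub>M i\<in>S. count_space UNIV)"
    and eq: "\<And>I. I \<subseteq> S \<Longrightarrow>
      measure L {f \<in> space (\<Pi>\<^sub>M i\<in>S. count_space UNIV). \<forall>i\<in>I. \<not> f i} =
      measure L' {f \<in> space (\<Pi>\<^sub>M i\<in>S. count_space UNIV). \<forall>i\<in>I. \<not> f i}"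
  shows "L = L'"
proof -
  \<comment> \<open>The configuration with set of ones T, undefined off S as the product space
    requires.\<close>
  define ind where "ind T = (\<lambda>i\<in>S. i \<in> T)" for T
  have "(\<Pi>\<^sub>M i\<in>S. count_space UNIV) = count_space (S \<rightarrow>\<^sub>E (UNIV :: bool set))"
    using S by (rule count_space_PiM_finite) simp
  then have sets': "sets L = Pow (S \<rightarrow>\<^sub>E UNIV)" "sets L' = Pow (S \<rightarrow>\<^sub>E UNIV)"
    using sets by simp_all
  have inj: "inj_on ind (Pow A)" if "A \<subseteq> S" for A
    using that by (intro inj_onI) (auto simp: ind_def restrict_def fun_eq_iff split: if_splits)
  have ind_mem: "ind T \<in> S \<rightarrow>\<^sub>E UNIV" for T
    by (auto simp: ind_def)
  have avoid: "{f \<in> space (\<Pi>\<^sub>M i\<in>S. count_space UNIV). \<forall>i\<in>S - A. \<not> f i} = ind ` Pow A"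
    if A: "A \<subseteq> S" for A
  proof (intro equalityI subsetI)
    fix f assume f: "f \<in> {f \<in> space (\<Pi>\<^sub>M i\<in>S. count_space UNIV). \<forall>i\<in>S - A. \<not> f i}"
    then have "f = ind {i \<in> S. f i}"
      by (auto simp: ind_def space_PiM fun_eq_iff PiE_def extensional_def)
    then show "f \<in> ind ` Pow A"
      using f by (intro image_eqI[of _ _ "{i \<in> S. f i}"]) auto
  qed (auto simp: ind_def space_PiM)
  have sum: "measure K (ind ` Pow A) = (\<Sum>T\<in>Pow A. measure K {ind T})"
    if A: "A \<subseteq> S" and K: "finite_measure K" "sets K = Pow (S \<rightarrow>\<^sub>E UNIV)" for A K
  proof -
    have "finite (ind ` Pow A)"
      using A S finite_subset by blast
    then have "measure K (ind ` Pow A) = (\<Sum>f\<in>ind ` Pow A. measure K {f})"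
      using K ind_mem by (intro finite_measure.finite_measure_eq_sum_singleton) auto
    then show ?thesis
      by (simp add: sum.reindex[OF inj[OF A]])
  qed
  have zero: "(\<Sum>T\<in>Pow A. measure L {ind T} - measure L' {ind T}) = 0" if A: "A \<subseteq> S" for A
    using sum[OF A fin(1) sets'(1)] sum[OF A fin(2) sets'(2)] eq[of "S - A"] avoid[OF A]
    by (simp add: sum_subtractf)
  have ind_eq: "measure L {ind T} = measure L' {ind T}" if "T \<subseteq> S" for T
    using moebius_fwd_diff[of S "\<lambda>T. measure L {ind T} - measure L' {ind T}" "\<lambda>_. 0" T] zero S that
    by simp
  show ?thesis
  proof (rule measure_eqI_finite[OF sets'])
    show "finite (S \<rightarrow>\<^sub>E (UNIV :: bool set))"
      using S by (intro finite_PiE) auto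
  next
    fix f assume "f \<in> S \<rightarrow>\<^sub>E (UNIV :: bool set)"
    then have "f = ind {i \<in> S. f i}"
      by (auto simp: ind_def fun_eq_iff PiE_def extensional_def)
    then show "emeasure L {f} = emeasure L' {f}"
      using ind_eq[of "{i \<in> S. f i}"] fin by (simp add: finite_measure.emeasure_eq_measure)
  qed
qed

lemma prob_space_process_law:
  assumes "prob_space M" and "\<And>i. i \<in> S \<Longrightarrow> X i \<in> M \<rightarrow>\<^sub>M count_space UNIV"
  shows "prob_space (process_law M S X)"
  unfolding process_law_def using assms by (intro prob_space.prob_space_distr measurable_restrict)

lemma sets_process_law [simp]: "sets (process_law M S X) = sets (\<Pi>\<^sub>M i\<in>S. count_space UNIV)"
  by (simp add: process_law_def)

lemma points_in_eq_0_iff: "points_in Y A \<omega> = 0 \<longleftrightarrow> set_mset (Y \<omega>) \<inter> A = {}"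
  by (auto simp: points_in_def)

text \<open>The union of the points misses I exactly if no point falls into the sets hitting I, and
  a Poisson count is 0 with probability exp of minus its mean.\<close>

lemma poisson_process_avoid:
  assumes P: "poisson_process P \<nu> Y" and \<nu>: "space \<nu> = Pow S - {{}}" "sets \<nu> = Pow (Pow S - {{}})"
  shows "i \<in> S \<Longrightarrow> cover_process Y i \<in> P \<rightarrow>\<^sub>M count_space UNIV"
    and "I \<subseteq> S \<Longrightarrow> measure P {\<omega> \<in> space P. \<forall>i\<in>I. \<not> cover_process Y i \<omega>} =
      exp (- measure \<nu> {T. T \<subseteq> S \<and> T \<inter> I \<noteq> {}})"
proof -
  have cover: "(\<forall>i\<in>I. \<not> cover_process Y i \<omega>) \<longleftrightarrow> points_in Y {T. T \<subseteq> S \<and> T \<inter> I \<noteq> {}} \<omega> = 0"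
    if "\<omega> \<in> space P" for I \<omega>
  proof -
    have "set_mset (Y \<omega>) \<subseteq> Pow S - {{}}"
      using P that \<nu> unfolding poisson_process_def by blast
    then show ?thesis
      unfolding points_in_eq_0_iff cover_process_def by fastforce
  qed
  have hit: "{T. T \<subseteq> S \<and> T \<inter> I \<noteq> {}} \<in> sets \<nu>" for I
    unfolding \<nu> by auto
  have meas [measurable]: "points_in Y {T. T \<subseteq> S \<and> T \<inter> I \<noteq> {}} \<in> P \<rightarrow>\<^sub>M count_space UNIV" for I
    using P hit[of I] unfolding poisson_process_def by blast
  show "cover_process Y i \<in> P \<rightarrow>\<^sub>M count_space UNIV"
  proof -
    have "cover_process Y i \<omega> \<longleftrightarrow> points_in Y {T. T \<subseteq> S \<and> T \<inter> {i} \<noteq> {}} \<omega> \<noteq> 0"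
      if "\<omega> \<in> space P" for \<omega>
      unfolding cover[OF that, symmetric] by blast
    then have "cover_process Y i \<in> P \<rightarrow>\<^sub>M count_space UNIV \<longleftrightarrow>
        (\<lambda>\<omega>. points_in Y {T. T \<subseteq> S \<and> T \<inter> {i} \<noteq> {}} \<omega> \<noteq> 0) \<in> P \<rightarrow>\<^sub>M count_space UNIV"
      by (rule measurable_cong)
    also have "\<dots>"
      by measurable
    finally show ?thesis .
  qed
  show "measure P {\<omega> \<in> space P. \<forall>i\<in>I. \<not> cover_process Y i \<omega>} =
      exp (- measure \<nu> {T. T \<subseteq> S \<and> T \<inter> I \<noteq> {}})"
  proof -
    have "{\<omega> \<in> space P. \<forall>i\<in>I. \<not> cover_process Y i \<omega>} =
        {\<omega> \<in> space P. points_in Y {T. T \<subseteq> S \<and> T \<inter> I \<noteq> {}} \<omega> = 0}"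
      using cover by auto
    moreover have "measure P {\<omega> \<in> space P. points_in Y A \<omega> = 0} = exp (- measure \<nu> A)"
      if "A \<in> sets \<nu>" for A
      using P that unfolding poisson_process_def by fastforce
    ultimately show ?thesis
      using hit by simp
  qed
qed

section \<open>Existence of Poisson processes on a finite ground set\<close>

text \<open>\<open>poisson_pmf\<close> is specified only for positive rates.\<close>

definition poisson0_pmf :: "real \<Rightarrow> nat pmf" where
  "poisson0_pmf r = (if r = 0 then return_pmf 0 else poisson_pmf r)"

lemma pmf_poisson0:
  assumes "0 \<le> r"
  shows "pmf (poisson0_pmf r) k = r ^ k / fact k * exp (- r)"
  using assms by (cases "k = 0") (auto simp: poisson0_pmf_def)

text \<open>The fibre over k consists of the pairs \<open>(i, k - i)\<close>, and the resulting
  convolution is the binomial expansion of \<open>(r + s) ^ k\<close>.\<close>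

lemma poisson0_add:
  assumes "0 \<le> r" "0 \<le> s"
  shows "map_pmf (\<lambda>(a, b). a + b) (pair_pmf (poisson0_pmf r) (poisson0_pmf s)) = poisson0_pmf (r + s)"
proof (rule pmf_eqI)
  fix k
  have "pmf (map_pmf (\<lambda>(a, b). a + b) (pair_pmf (poisson0_pmf r) (poisson0_pmf s))) k =
      measure_pmf.prob (pair_pmf (poisson0_pmf r) (poisson0_pmf s)) ((\<lambda>i. (i, k - i)) ` {..k})"
    unfolding pmf_map by (rule arg_cong[where f = "measure_pmf.prob _"]) (force simp: image_iff)
  also have "\<dots> = (\<Sum>i\<le>k. pmf (poisson0_pmf r) i * pmf (poisson0_pmf s) (k - i))"
    by (subst measure_measure_pmf_finite) (auto simp: sum.reindex inj_on_def pmf_pair)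
  also have "\<dots> = (\<Sum>i\<le>k. of_nat (k choose i) * r ^ i * s ^ (k - i)) / fact k * exp (- (r + s))"
    unfolding sum_distrib_right sum_divide_distrib using assms
    by (intro sum.cong) (auto simp: pmf_poisson0 binomial_fact mult_exp_exp field_simps)
  also have "\<dots> = pmf (poisson0_pmf (r + s)) k"
    using assms by (simp add: pmf_poisson0 binomial_ring)
  finally show "pmf (map_pmf (\<lambda>(a, b). a + b) (pair_pmf (poisson0_pmf r) (poisson0_pmf s))) k =
      pmf (poisson0_pmf (r + s)) k" .
qed

lemma poisson0_sum:
  assumes "finite E" "A \<subseteq> E" "\<And>T. T \<in> A \<Longrightarrow> 0 \<le> w T"
  shows "map_pmf (\<lambda>f. \<Sum>T\<in>A. f T) (Pi_pmf E 0 (\<lambda>T. poisson0_pmf (w T))) = poisson0_pmf (sum w A)"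
proof -
  have "map_pmf (\<lambda>f. \<Sum>T\<in>A. f T) (Pi_pmf A 0 (\<lambda>T. poisson0_pmf (w T))) = poisson0_pmf (sum w A)"
    if "finite A" using that assms(3)
  proof (induction A rule: finite_induct)
    case empty
    then show ?case by (simp add: poisson0_pmf_def)
  next
    case (insert x A)
    have "map_pmf (\<lambda>f. \<Sum>T\<in>insert x A. f T) (Pi_pmf (insert x A) 0 (\<lambda>T. poisson0_pmf (w T))) =
        map_pmf (\<lambda>(a, f). a + (\<Sum>T\<in>A. f T))
          (pair_pmf (poisson0_pmf (w x)) (Pi_pmf A 0 (\<lambda>T. poisson0_pmf (w T))))"
    proof -
      have "(\<Sum>T\<in>A. (f(x := y)) T) = (\<Sum>T\<in>A. f T)" for f :: "'a \<Rightarrow> nat" and y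
        using insert.hyps by (intro sum.cong) auto
      then show ?thesis
        using insert.hyps by (simp add: Pi_pmf_insert pmf.map_comp o_def case_prod_unfold)
    qed
    also have "\<dots> = map_pmf (\<lambda>(a, b). a + b) (map_pmf (apsnd (\<lambda>f. \<Sum>T\<in>A. f T))
        (pair_pmf (poisson0_pmf (w x)) (Pi_pmf A 0 (\<lambda>T. poisson0_pmf (w T)))))"
      by (simp add: pmf.map_comp o_def case_prod_unfold)
    also have "\<dots> = map_pmf (\<lambda>(a, b). a + b) (pair_pmf (poisson0_pmf (w x)) (poisson0_pmf (sum w A)))"
      using insert by (simp add: pair_map_pmf2[symmetric])
    also have "\<dots> = poisson0_pmf (sum w (insert x A))"
      using insert by (subst poisson0_add) (auto intro: sum_nonneg)
    finally show ?case .
  qed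
  moreover have "map_pmf (\<lambda>f. \<Sum>T\<in>A. f T) (Pi_pmf A 0 (\<lambda>T. poisson0_pmf (w T))) =
      map_pmf (\<lambda>f. \<Sum>T\<in>A. f T) (Pi_pmf E 0 (\<lambda>T. poisson0_pmf (w T)))"
    by (subst Pi_pmf_subset[OF assms(1,2)]) (simp add: pmf.map_comp o_def)
  ultimately show ?thesis
    using assms finite_subset by metis
qed

text \<open>Independence is available for families of multiplicities, but the process must live on
  multisets; this transports it along the map between them.\<close>

lemma indep_vars_map_pmf:
  assumes "prob_space.indep_vars (measure_pmf p) (\<lambda>_. count_space UNIV) (\<lambda>i x. X i (g x)) I"
  shows "prob_space.indep_vars (measure_pmf (map_pmf g p)) (\<lambda>_. count_space UNIV) X I"
proof -
  note def2 = prob_space.indep_vars_def2[OF measure_pmf.prob_space_axioms]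
  note indep_setsD = prob_space.indep_setsD[OF measure_pmf.prob_space_axioms]
  note indep_setsI = prob_space.indep_setsI[OF measure_pmf.prob_space_axioms]
  have "measure_pmf.prob (map_pmf g p) (\<Inter>j\<in>J. A j) = (\<Prod>j\<in>J. measure_pmf.prob (map_pmf g p) (A j))"
    if J: "J \<subseteq> I" "J \<noteq> {}" "finite J" and A: "\<And>j. j \<in> J \<Longrightarrow> \<exists>B. A j = X j -` B" for J A
  proof -
    have "measure_pmf.prob p (\<Inter>j\<in>J. g -` A j) = (\<Prod>j\<in>J. measure_pmf.prob p (g -` A j))"
    proof (rule indep_setsD[OF _ J])
      show "prob_space.indep_sets (measure_pmf p)
          (\<lambda>i. {(\<lambda>x. X i (g x)) -` B \<inter> space (measure_pmf p) | B. B \<in> sets (count_space UNIV)}) I"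
        using assms unfolding def2 by blast
      show "\<forall>j\<in>J. g -` A j \<in>
          {(\<lambda>x. X j (g x)) -` B \<inter> space (measure_pmf p) | B. B \<in> sets (count_space UNIV)}"
        using A by (fastforce simp: vimage_def)
    qed
    then show ?thesis
      by (simp add: vimage_INT)
  qed
  then show ?thesis
    unfolding def2 by (intro conjI indep_setsI) (auto simp del: measure_map_pmf)
qed

lemma filter_mset_sum: "filter_mset P (\<Sum>x\<in>A. f x) = (\<Sum>x\<in>A. filter_mset P (f x))"
  by (induction A rule: infinite_finite_induct) auto

lemma filter_replicate_mset:
  "filter_mset P (replicate_mset n x) = (if P x then replicate_mset n x else {#})"
  by (induction n) auto

text \<open>Give each T in E an independent Poisson multiplicity with mean \<open>w T\<close>. The
  count in A is then a sum over the coordinates in A: Poisson by additivity, and independent for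
  disjoint sets because these use disjoint blocks of coordinates.\<close>

lemma poisson_process_exists:
  fixes w :: "'b \<Rightarrow> real"
  assumes E: "finite E" and w: "\<And>T. T \<in> E \<Longrightarrow> 0 \<le> w T"
  shows "\<exists>(P :: 'b multiset measure) Y. poisson_process P (point_measure E (\<lambda>T. ennreal (w T))) Y"
proof -
  define \<nu> where "\<nu> = point_measure E (\<lambda>T. ennreal (w T))"
  define p where "p = Pi_pmf E 0 (\<lambda>T. poisson0_pmf (w T))"
  define g :: "('b \<Rightarrow> nat) \<Rightarrow> 'b multiset" where "g f = (\<Sum>T\<in>E. replicate_mset (f T) T)" for f
  \<comment> \<open>\<open>g\<close> only produces points of \<open>E\<close>; the filter is there because the space of a pmf is the whole type.\<close>
  define Y :: "'b multiset \<Rightarrow> 'b multiset" where "Y = filter_mset (\<lambda>T. T \<in> E)"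
  have \<nu>_sets [simp]: "space \<nu> = E" "sets \<nu> = Pow E"
    by (simp_all add: \<nu>_def space_point_measure sets_point_measure)
  have \<nu>_measure: "emeasure \<nu> A = ennreal (sum w A)" if "A \<subseteq> E" for A
  proof -
    have "emeasure \<nu> A = (\<Sum>T\<in>A. ennreal (w T))"
      unfolding \<nu>_def using E that by (rule emeasure_point_measure_finite)
    then show ?thesis
      using that w by (subst (asm) sum_ennreal) auto
  qed
  have points: "points_in Y A (g f) = (\<Sum>T\<in>A. f T)" if "A \<subseteq> E" for A f
  proof -
    have "filter_mset (\<lambda>T. T \<in> A) (Y (g f)) = filter_mset (\<lambda>T. T \<in> A) (g f)"
      unfolding Y_def filter_filter_mset using that by (intro filter_mset_cong) auto
    also have "\<dots> = (\<Sum>T\<in>E. if T \<in> A then replicate_mset (f T) T else {#})"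
      unfolding g_def by (simp add: filter_mset_sum filter_replicate_mset)
    also have "\<dots> = (\<Sum>T\<in>A. replicate_mset (f T) T)"
      using E that by (intro sum.mono_neutral_cong_right) auto
    finally show ?thesis
      by (simp add: points_in_def size_multiset_sum)
  qed
  have "prob_space.indep_vars (measure_pmf (map_pmf g p)) (\<lambda>_. count_space UNIV) (points_in Y) F"
    if F: "F \<subseteq> Pow E" "disjoint F" for F
  proof (rule indep_vars_map_pmf)
    have "prob_space.indep_vars (measure_pmf p) (\<lambda>_. count_space UNIV) (\<lambda>T f. f T) E"
      unfolding p_def using E by (rule indep_vars_Pi_pmf)
    then have "prob_space.indep_vars (measure_pmf p) (\<lambda>A. \<Pi>\<^sub>M T\<in>A. count_space UNIV) (\<lambda>A f. \<lambda>T\<in>A. f T) F"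
      by (rule prob_space.indep_vars_restrict[OF measure_pmf.prob_space_axioms])
        (use F in \<open>auto simp: disjoint_family_on_def disjoint_def\<close>)
    then have "prob_space.indep_vars (measure_pmf p) (\<lambda>_. count_space UNIV) (\<lambda>A f. \<Sum>T\<in>A. (\<lambda>T\<in>A. f T) T) F"
      by (rule prob_space.indep_vars_compose2[OF measure_pmf.prob_space_axioms]) measurable
    also have "?this \<longleftrightarrow> prob_space.indep_vars (measure_pmf p) (\<lambda>_. count_space UNIV) (\<lambda>A f. points_in Y A (g f)) F"
      using points F by (intro prob_space.indep_vars_cong[OF measure_pmf.prob_space_axioms]) (auto simp: fun_eq_iff subset_eq)
    finally show "prob_space.indep_vars (measure_pmf p) (\<lambda>_. count_space UNIV) (\<lambda>A f. points_in Y A (g f)) F" .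
  qed
  moreover have "measure_pmf.prob (map_pmf g p) {m. points_in Y A m = k} =
      measure \<nu> A ^ k / fact k * exp (- measure \<nu> A)" if "A \<subseteq> E" for A k
  proof -
    have "measure_pmf.prob (map_pmf g p) {m. points_in Y A m = k} =
        pmf (map_pmf (\<lambda>f. \<Sum>T\<in>A. f T) p) k"
      using points[OF that] by (simp add: pmf_map vimage_def)
    also have "\<dots> = pmf (poisson0_pmf (sum w A)) k"
      unfolding p_def using that E w by (subst poisson0_sum) auto
    also have "\<dots> = sum w A ^ k / fact k * exp (- sum w A)"
      using that w by (intro pmf_poisson0 sum_nonneg) auto
    also have "sum w A = measure \<nu> A"
      unfolding measure_def \<nu>_measure[OF that] using that w by (simp add: sum_nonneg subset_eq)
    finally show ?thesis .
  qed
  moreover have "finite_measure \<nu>"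
    by (rule finite_measureI) (simp add: \<nu>_measure)
  moreover have "set_mset (Y m) \<subseteq> E" for m
    by (auto simp: Y_def)
  ultimately have "poisson_process (measure_pmf (map_pmf g p)) \<nu> Y"
    unfolding poisson_process_def by (auto simp: measure_pmf.prob_space_axioms simp del: measure_map_pmf)
  then show ?thesis
    unfolding \<nu>_def by blast
qed

text \<open>Removes the Poisson process from the problem: the weights are the point masses of the
  intensity. Conversely, a process built from given weights has the right avoidance probabilities,
  and these determine the law.\<close>

lemma process_law_poisson_representable_iff:
  assumes S: "finite S" and M: "prob_space M" and X: "\<And>i. i \<in> S \<Longrightarrow> X i \<in> M \<rightarrow>\<^sub>M count_space UNIV"
  shows "process_law M S X \<in> poisson_representable_laws S \<longleftrightarrow>
    (\<exists>w. (\<forall>T. 0 \<le> w T) \<and> (\<forall>I\<subseteq>S. measure M {\<omega> \<in> space M. \<forall>i\<in>I. \<not> X i \<omega>} =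
       exp (- (\<Sum>T | T \<subseteq> S \<and> T \<inter> I \<noteq> {}. w T))))"
    (is "_ \<longleftrightarrow> ?R")
proof
  assume "process_law M S X \<in> poisson_representable_laws S"
  then obtain \<nu> Y and P :: "'a set multiset measure" where
    law: "process_law M S X = process_law P S (cover_process Y)"
    and \<nu>: "space \<nu> = Pow S - {{}}" "sets \<nu> = Pow (Pow S - {{}})" and P: "poisson_process P \<nu> Y"
    unfolding poisson_representable_laws_def by blast
  have "prob_space P" "finite_measure \<nu>"
    using P unfolding poisson_process_def by auto
  have "measure M {\<omega> \<in> space M. \<forall>i\<in>I. \<not> X i \<omega>} =
       exp (- (\<Sum>T | T \<subseteq> S \<and> T \<inter> I \<noteq> {}. measure \<nu> {T}))" if I: "I \<subseteq> S" for I
  proof -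
    have "finite I" "finite {T. T \<subseteq> S \<and> T \<inter> I \<noteq> {}}"
      using I S finite_subset by auto
    then have "measure M {\<omega> \<in> space M. \<forall>i\<in>I. \<not> X i \<omega>} =
        measure P {\<omega> \<in> space P. \<forall>i\<in>I. \<not> cover_process Y i \<omega>}"
      using measure_process_law_avoid[of M S X I] M X I
        measure_process_law_avoid[of P S "cover_process Y" I] \<open>prob_space P\<close>
        poisson_process_avoid(1)[OF P \<nu>]
      by (simp add: law)
    also have "\<dots> = exp (- measure \<nu> {T. T \<subseteq> S \<and> T \<inter> I \<noteq> {}})"
      using poisson_process_avoid(2)[OF P \<nu> I] .
    also have "measure \<nu> {T. T \<subseteq> S \<and> T \<inter> I \<noteq> {}} = (\<Sum>T | T \<subseteq> S \<and> T \<inter> I \<noteq> {}. measure \<nu> {T})"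
      using \<open>finite_measure \<nu>\<close> \<open>finite {T. T \<subseteq> S \<and> T \<inter> I \<noteq> {}}\<close> \<nu>
      by (intro finite_measure.finite_measure_eq_sum_singleton) auto
    finally show ?thesis .
  qed
  then show ?R
    by (intro exI[of _ "\<lambda>T. measure \<nu> {T}"]) auto
next
  assume ?R
  then obtain w where w: "\<And>T. 0 \<le> w T"
    and avoid: "\<And>I. I \<subseteq> S \<Longrightarrow> measure M {\<omega> \<in> space M. \<forall>i\<in>I. \<not> X i \<omega>} =
       exp (- (\<Sum>T | T \<subseteq> S \<and> T \<inter> I \<noteq> {}. w T))"
    by blast
  define \<nu> where "\<nu> = point_measure (Pow S - {{}}) (\<lambda>T. ennreal (w T))"
  have fin: "finite (Pow S - {{}})" using S by simp
  obtain Y and P :: "'a set multiset measure" where P: "poisson_process P \<nu> Y"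
    unfolding \<nu>_def using poisson_process_exists[OF fin] w by blast
  have \<nu>: "space \<nu> = Pow S - {{}}" "sets \<nu> = Pow (Pow S - {{}})"
    by (simp_all add: \<nu>_def space_point_measure sets_point_measure)
  have "prob_space P" "finite_measure \<nu>"
    using P unfolding poisson_process_def by auto
  have "process_law M S X = process_law P S (cover_process Y)"
  proof (rule law_eqI_avoid[OF S])
    show "finite_measure (process_law M S X)" "finite_measure (process_law P S (cover_process Y))"
      using prob_space_process_law[of M S X] M X
        prob_space_process_law[of P S "cover_process Y"] \<open>prob_space P\<close> poisson_process_avoid(1)[OF P \<nu>]
      by (auto intro: prob_space.finite_measure)
    fix I assume I: "I \<subseteq> S"
    then have "finite I"
      using S finite_subset by blast
    have hit: "{T. T \<subseteq> S \<and> T \<inter> I \<noteq> {}} \<subseteq> Pow S - {{}}"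
      by auto
    have "emeasure \<nu> {T. T \<subseteq> S \<and> T \<inter> I \<noteq> {}} = (\<Sum>T | T \<subseteq> S \<and> T \<inter> I \<noteq> {}. ennreal (w T))"
      unfolding \<nu>_def using fin hit by (rule emeasure_point_measure_finite)
    then have "measure \<nu> {T. T \<subseteq> S \<and> T \<inter> I \<noteq> {}} = (\<Sum>T | T \<subseteq> S \<and> T \<inter> I \<noteq> {}. w T)"
      using w by (simp add: measure_def sum_nonneg)
    then show "measure (process_law M S X) {f \<in> space (\<Pi>\<^sub>M i\<in>S. count_space UNIV). \<forall>i\<in>I. \<not> f i} =
        measure (process_law P S (cover_process Y))
          {f \<in> space (\<Pi>\<^sub>M i\<in>S. count_space UNIV). \<forall>i\<in>I. \<not> f i}"
      using measure_process_law_avoid[of M S X I] M X I \<open>finite I\<close> avoid[OF I]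
        measure_process_law_avoid[of P S "cover_process Y" I] \<open>prob_space P\<close>
        poisson_process_avoid[OF P \<nu>]
      by simp
  qed simp_all
  moreover have "sigma_finite_measure \<nu>"
    using \<open>finite_measure \<nu>\<close> by (simp add: finite_measure_def)
  ultimately show "process_law M S X \<in> poisson_representable_laws S"
    unfolding poisson_representable_laws_def using \<nu> P by blast
qed

section \<open>Avoidance probabilities of product measures and their mixtures\<close>

lemma emeasure_bernoulli_product_avoid:
  assumes "0 \<le> p" "p \<le> 1" "I \<subseteq> {1..}" "finite I"
  shows "emeasure (bernoulli_product p) {f \<in> space (\<Pi>\<^sub>M i\<in>{1..}. count_space UNIV). \<forall>i\<in>I. \<not> f i} =
    ennreal ((1 - p) ^ card I)"
proof -
  interpret product_prob_space "\<lambda>_. measure_pmf (bernoulli_pmf p)" "{1::nat..}"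
    by (intro product_prob_spaceI measure_pmf.prob_space_axioms)
  have "{f \<in> space (\<Pi>\<^sub>M i\<in>{1::nat..}. count_space UNIV). \<forall>i\<in>I. \<not> f i} =
      prod_emb {1..} (\<lambda>_. measure_pmf (bernoulli_pmf p)) I (\<Pi>\<^sub>E i\<in>I. {False})"
  proof -
    have "restrict f I \<in> (\<Pi>\<^sub>E i\<in>I. {False}) \<longleftrightarrow> (\<forall>i\<in>I. \<not> f i)" for f
      unfolding restrict_PiE_iff by simp
    then show ?thesis
      unfolding prod_emb_def vimage_def space_PiM by auto
  qed
  then have "emeasure (bernoulli_product p)
        {f \<in> space (\<Pi>\<^sub>M i\<in>{1..}. count_space UNIV). \<forall>i\<in>I. \<not> f i} =
      (\<Prod>i\<in>I. emeasure (measure_pmf (bernoulli_pmf p)) {False})"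
    unfolding bernoulli_product_def using emeasure_PiM_emb[OF assms(3,4), of "\<lambda>_. {False}"] by simp
  then show ?thesis
    using assms by (simp add: emeasure_pmf_single ennreal_power)
qed

lemma measure_mixture_avoid:
  assumes "0 < q" "q \<le> 1" "0 \<le> x" "x \<le> 1" "0 \<le> \<alpha>" "\<alpha> \<le> 1" "prob_space M"
    and X: "\<And>j. 1 \<le> j \<Longrightarrow> X j \<in> M \<rightarrow>\<^sub>M count_space UNIV"
    and law: "process_law M {1..} X =
      mixture (1 - \<alpha>) (bernoulli_product (1 - q)) \<alpha> (bernoulli_product (1 - q * x))"
    and I: "I \<subseteq> {1..}" "finite I"
  shows "measure M {\<omega> \<in> space M. \<forall>i\<in>I. \<not> X i \<omega>} = mixture_avoid \<alpha> q x (card I)"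
proof -
  let ?A = "{f \<in> space (\<Pi>\<^sub>M i\<in>{1::nat..}. count_space UNIV). \<forall>i\<in>I. \<not> f i}"
  have sets: "sets (bernoulli_product p) = sets (\<Pi>\<^sub>M i\<in>{1::nat..}. count_space UNIV)" for p
    unfolding bernoulli_product_def by (intro sets_PiM_cong) auto
  have A: "?A \<in> sets (bernoulli_product (1 - q))"
    unfolding sets using I by (intro avoid_event_in_sets)
  have "q * x \<le> 1"
    using assms by (simp add: mult_le_one)
  have "emeasure (process_law M {1..} X) ?A =
      ennreal (1 - \<alpha>) * ennreal (q ^ card I) + ennreal \<alpha> * ennreal ((q * x) ^ card I)"
    unfolding law
    using emeasure_mixture[of "bernoulli_product (1 - q)" "bernoulli_product (1 - q * x)" ?A] A sets
      emeasure_bernoulli_product_avoid[of "1 - q" I] emeasure_bernoulli_product_avoid[of "1 - q * x" I]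
      assms \<open>q * x \<le> 1\<close> by simp
  also have "\<dots> = ennreal (mixture_avoid \<alpha> q x (card I))"
    using assms by (simp add: mixture_avoid_def ennreal_mult[symmetric] ennreal_plus[symmetric] del: ennreal_plus)
  finally have "emeasure (process_law M {1..} X) ?A = ennreal (mixture_avoid \<alpha> q x (card I))" .
  moreover have "mixture_avoid \<alpha> q x (card I) \<ge> 0"
    using assms by (simp add: mixture_avoid_def)
  ultimately have "measure (process_law M {1..} X) ?A = mixture_avoid \<alpha> q x (card I)"
    by (simp only: measure_def enn2real_ennreal)
  then show ?thesis
    using measure_process_law_avoid[of M "{1..}" X I] assms by simp
qed


section \<open>Mixtures of two product measures\<close>

lemma signed_measure_of_sum:
  assumes "finite S" "prob_space M" "I \<subseteq> S"
  shows "(\<Sum>T | T \<subseteq> S \<and> T \<inter> I \<noteq> {}. signed_measure_of S M X {T}) =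
    - ln (measure M {\<omega> \<in> space M. \<forall>i\<in>I. \<not> X i \<omega>})"
proof -
  have \<nu>: "signed_measure_on (Pow (Pow S - {{}})) (signed_measure_of S M X)"
      "signed_measure_of S M X {T. T \<subseteq> S \<and> T \<inter> I \<noteq> {}} =
        - ln (measure M {\<omega> \<in> space M. \<forall>i\<in>I. \<not> X i \<omega>})"
    using corresponds_to_signed_measure_of[OF assms(1,2), of X] assms(3)
    unfolding corresponds_to_def by blast+
  have "signed_measure_of S M X {T. T \<subseteq> S \<and> T \<inter> I \<noteq> {}} =
      (\<Sum>T | T \<subseteq> S \<and> T \<inter> I \<noteq> {}. signed_measure_of S M X {T})"
    using assms(1) by (intro signed_measure_on_eq_sum[OF \<nu>(1)]) auto
  then show ?thesis
    using \<nu>(2) by simp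
qed

lemma signed_measure_of_eq_mass:
  assumes "0 < \<alpha>" "\<alpha> < 1" "0 < q" "0 < x" "finite S" "prob_space M"
    and "\<And>I. I \<subseteq> S \<Longrightarrow> measure M {\<omega> \<in> space M. \<forall>i\<in>I. \<not> X i \<omega>} = mixture_avoid \<alpha> q x (card I)"
    and "B \<subseteq> S" "B \<noteq> {}"
  shows "signed_measure_of S M X {B} = mass \<alpha> q x (card S) (card B)"
  using assms signed_measure_of_sum[OF assms(5,6), of _ X]
  by (intro avoid_weights_eq_mass[where w = "\<lambda>T. signed_measure_of S M X {T}"]) simp_all

text \<open>The avoidance probabilities force the weight of every nonempty set to be its mass, so a
  representing intensity exists exactly if no mass is negative.\<close>

lemma mixture_representable_iff:
  assumes "0 < \<alpha>" "\<alpha> < 1" "0 < q" "0 < x" "finite S" "prob_space M"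
    and X: "\<And>i. i \<in> S \<Longrightarrow> X i \<in> M \<rightarrow>\<^sub>M count_space UNIV"
    and avoid: "\<And>I. I \<subseteq> S \<Longrightarrow>
      measure M {\<omega> \<in> space M. \<forall>i\<in>I. \<not> X i \<omega>} = mixture_avoid \<alpha> q x (card I)"
  shows "process_law M S X \<in> poisson_representable_laws S \<longleftrightarrow>
    (\<forall>k\<in>{1..card S}. mass \<alpha> q x (card S) k \<ge> 0)"
proof
  assume "process_law M S X \<in> poisson_representable_laws S"
  then obtain w where w: "\<And>T. 0 \<le> w T" and eq: "\<And>I. I \<subseteq> S \<Longrightarrow>
      mixture_avoid \<alpha> q x (card I) = exp (- (\<Sum>T | T \<subseteq> S \<and> T \<inter> I \<noteq> {}. w T))"
    using process_law_poisson_representable_iff[of S M X] assms(5-7) avoid by auto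
  show "\<forall>k\<in>{1..card S}. mass \<alpha> q x (card S) k \<ge> 0"
  proof
    fix k assume k: "k \<in> {1..card S}"
    obtain B where B: "B \<subseteq> S" "card B = k"
      using k obtain_subset_with_card_n[of k S] by auto
    then have "w B = mass \<alpha> q x (card S) (card B)"
      using assms(1-5) k eq by (intro avoid_weights_eq_mass) auto
    then show "mass \<alpha> q x (card S) k \<ge> 0"
      using w[of B] B by simp
  qed
next
  assume mass: "\<forall>k\<in>{1..card S}. mass \<alpha> q x (card S) k \<ge> 0"
  \<comment> \<open>The candidate intensity is the signed measure itself, set to 0 where it carries
    no information, so that nonnegativity holds for every T.\<close>
  define w where "w T = (if T \<subseteq> S \<and> T \<noteq> {} then signed_measure_of S M X {T} else 0)" for T
  have "0 \<le> w T" for T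
  proof (cases "T \<subseteq> S \<and> T \<noteq> {}")
    case True
    then have "card T \<in> {1..card S}"
      using \<open>finite S\<close> by (auto simp: card_mono Suc_le_eq card_gt_0_iff finite_subset)
    then show ?thesis
      using True mass signed_measure_of_eq_mass[OF assms(1-6) avoid] by (simp add: w_def)
  qed (auto simp: w_def)
  moreover have "measure M {\<omega> \<in> space M. \<forall>i\<in>I. \<not> X i \<omega>} =
       exp (- (\<Sum>T | T \<subseteq> S \<and> T \<inter> I \<noteq> {}. w T))" if I: "I \<subseteq> S" for I
  proof -
    have "(\<Sum>T | T \<subseteq> S \<and> T \<inter> I \<noteq> {}. w T) =
        (\<Sum>T | T \<subseteq> S \<and> T \<inter> I \<noteq> {}. signed_measure_of S M X {T})"
      by (intro sum.cong) (auto simp: w_def)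
    then show ?thesis
      using signed_measure_of_sum[OF assms(5,6) I, of X] avoid[OF I] mixture_avoid_pos[OF assms(1-4)]
      by simp
  qed
  ultimately show "process_law M S X \<in> poisson_representable_laws S"
    using process_law_poisson_representable_iff[of S M X] assms(5-7) by blast
qed

theorem theorem5p6:
  fixes \<alpha>\<^sub>1 \<alpha>\<^sub>2 q x\<^sub>1 :: real and n :: nat
    and M :: "real \<Rightarrow> 'w measure" and X :: "real \<Rightarrow> nat \<Rightarrow> 'w \<Rightarrow> bool"
  assumes "x\<^sub>1 = 1"
    and "q \<in> {0<..1}"
    and "\<alpha>\<^sub>1 \<in> {0<..<1}" and "\<alpha>\<^sub>2 \<in> {0<..<1}" and "\<alpha>\<^sub>1 + \<alpha>\<^sub>2 = 1"
    and "3 \<le> n"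
    and "\<And>x\<^sub>2. 0 \<le> x\<^sub>2 \<Longrightarrow> x\<^sub>2 < x\<^sub>1 \<Longrightarrow> prob_space (M x\<^sub>2)"
    and "\<And>x\<^sub>2 j. 0 \<le> x\<^sub>2 \<Longrightarrow> x\<^sub>2 < x\<^sub>1 \<Longrightarrow> 1 \<le> j \<Longrightarrow> X x\<^sub>2 j \<in> M x\<^sub>2 \<rightarrow>\<^sub>M count_space UNIV"
    and "\<And>x\<^sub>2. 0 \<le> x\<^sub>2 \<Longrightarrow> x\<^sub>2 < x\<^sub>1 \<Longrightarrow>
           process_law (M x\<^sub>2) {1..} (X x\<^sub>2) =
             mixture \<alpha>\<^sub>1 (bernoulli_product (1 - q * x\<^sub>1)) \<alpha>\<^sub>2 (bernoulli_product (1 - q * x\<^sub>2))"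
  shows "(\<forall>k\<in>{3..n}.
           (Re (polylog (1 - real k) (of_real (- inverse \<alpha>\<^sub>1 * (1 - \<alpha>\<^sub>1)))) < 0 \<longrightarrow>
              (\<forall>\<^sub>F x\<^sub>2 in at_left 1. signed_measure_of {1..n} (M x\<^sub>2) (X x\<^sub>2) {{1..k}} > 0)) \<and>
           (Re (polylog (1 - real k) (of_real (- inverse \<alpha>\<^sub>1 * (1 - \<alpha>\<^sub>1)))) > 0 \<longrightarrow>
              (\<forall>\<^sub>F x\<^sub>2 in at_left 1. signed_measure_of {1..n} (M x\<^sub>2) (X x\<^sub>2) {{1..k}} < 0))) \<and>
         (\<alpha>\<^sub>1 \<ge> 1 / (1 - largest_negative_root n) \<longleftrightarrow>
           (\<forall>\<^sub>F x\<^sub>2 in at_left 1.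
              process_law (M x\<^sub>2) {1..n} (X x\<^sub>2) \<in> poisson_representable_laws {1..n}))"
proof -
  have \<alpha>: "0 < \<alpha>\<^sub>2" "\<alpha>\<^sub>2 < 1" "\<alpha>\<^sub>1 = 1 - \<alpha>\<^sub>2" and q: "0 < q" "q \<le> 1"
    using assms(2-5) by auto
  \<comment> \<open>Only x near 1 matters; excluding x = 0 gives \<open>ln x\<close> its meaning as
    a logarithm.\<close>
  have near: "\<forall>\<^sub>F x in at_left (1::real). 0 < x \<and> x < 1"
    using eventually_at_left_real[of 0 "1::real"] by (auto elim: eventually_mono)
  have M: "prob_space (M x)" and X: "1 \<le> j \<Longrightarrow> X x j \<in> M x \<rightarrow>\<^sub>M count_space UNIV"
    and avoid: "I \<subseteq> {1..n} \<Longrightarrow> measure (M x) {\<omega> \<in> space (M x). \<forall>i\<in>I. \<not> X x i \<omega>} =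
      mixture_avoid \<alpha>\<^sub>2 q x (card I)" if x: "0 < x \<and> x < 1" for x j I
  proof -
    show M: "prob_space (M x)" and X: "1 \<le> j \<Longrightarrow> X x j \<in> M x \<rightarrow>\<^sub>M count_space UNIV" for j
      using assms(1,7,8) x by auto
    have "process_law (M x) {1..} (X x) =
        mixture (1 - \<alpha>\<^sub>2) (bernoulli_product (1 - q)) \<alpha>\<^sub>2 (bernoulli_product (1 - q * x))"
      using assms(1,9) x \<alpha> by simp
    then show "measure (M x) {\<omega> \<in> space (M x). \<forall>i\<in>I. \<not> X x i \<omega>} = mixture_avoid \<alpha>\<^sub>2 q x (card I)"
      if I: "I \<subseteq> {1..n}"
    proof -
      have "I \<subseteq> {1..}" "finite I"
        using I finite_subset by auto
      then show ?thesis
        using measure_mixture_avoid[of q x \<alpha>\<^sub>2 "M x" "X x" I] M X \<alpha> q x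
          \<open>process_law (M x) {1..} (X x) = _\<close> by simp
    qed
  qed
  have rep: "process_law (M x) {1..n} (X x) \<in> poisson_representable_laws {1..n} \<longleftrightarrow>
      (\<forall>k\<in>{1..n}. mass \<alpha>\<^sub>2 q x n k \<ge> 0)" if x: "0 < x \<and> x < 1" for x
    using mixture_representable_iff[of \<alpha>\<^sub>2 q x "{1..n}" "M x" "X x"] M[OF x] X[OF x] avoid[OF x] \<alpha> q x
    by simp
  have signed: "signed_measure_of {1..n} (M x) (X x) {{1..k}} = mass \<alpha>\<^sub>2 q x n k"
    if x: "0 < x \<and> x < 1" and k: "1 \<le> k" "k \<le> n" for x k
    using signed_measure_of_eq_mass[of \<alpha>\<^sub>2 q x "{1..n}" "M x" "X x" "{1..k}"] M[OF x] avoid[OF x] \<alpha> q x k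
    by simp
  \<comment> \<open>The argument is the point whose coordinate \<open>z / (z - 1)\<close> equals
    \<open>\<alpha>\<^sub>2\<close>. The polylogarithm is real there, so \<open>Re\<close> loses
    nothing.\<close>
  have polylog_eq: "Re (polylog (1 - real k) (of_real (- inverse \<alpha>\<^sub>1 * (1 - \<alpha>\<^sub>1)))) =
      - poly (logistic_poly (k - 1)) \<alpha>\<^sub>2" if "3 \<le> k" for k
  proof -
    define z where "z = - inverse \<alpha>\<^sub>1 * (1 - \<alpha>\<^sub>1)"
    have "z = - \<alpha>\<^sub>2 / (1 - \<alpha>\<^sub>2)"
      using \<alpha> by (simp add: z_def field_simps)
    moreover from this have "z - 1 = - 1 / (1 - \<alpha>\<^sub>2)"
      using \<alpha> by (simp add: field_simps)
    ultimately have "z \<noteq> 1" "z / (z - 1) = \<alpha>\<^sub>2"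
      using \<alpha> by auto
    then have "polylog (- real (k - 1)) (of_real z) = of_real (- poly (logistic_poly (k - 1)) \<alpha>\<^sub>2)"
      using polylog_neg_of_real[of z "k - 1"] by simp
    moreover have "1 - real k = - real (k - 1)"
      using that by (simp add: of_nat_diff)
    ultimately show ?thesis
      unfolding z_def by (metis Re_complex_of_real)
  qed
  have sgn_signed: "\<forall>\<^sub>F x in at_left 1. sgn (signed_measure_of {1..n} (M x) (X x) {{1..k}}) =
      sgn (poly (logistic_poly (k - 1)) \<alpha>\<^sub>2)"
    if "k \<in> {3..n}" "poly (logistic_poly (k - 1)) \<alpha>\<^sub>2 \<noteq> 0" for k
  proof -
    have "\<forall>\<^sub>F x in at_left 1. sgn (mass \<alpha>\<^sub>2 q x n k) = sgn (poly (logistic_poly (k - 1)) \<alpha>\<^sub>2)"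
      using that \<alpha> by (intro eventually_sgn_mass) auto
    with near show ?thesis
      by eventually_elim (use signed that in auto)
  qed
  have a: "(Re (polylog (1 - real k) (of_real (- inverse \<alpha>\<^sub>1 * (1 - \<alpha>\<^sub>1)))) < 0 \<longrightarrow>
              (\<forall>\<^sub>F x\<^sub>2 in at_left 1. signed_measure_of {1..n} (M x\<^sub>2) (X x\<^sub>2) {{1..k}} > 0)) \<and>
           (Re (polylog (1 - real k) (of_real (- inverse \<alpha>\<^sub>1 * (1 - \<alpha>\<^sub>1)))) > 0 \<longrightarrow>
              (\<forall>\<^sub>F x\<^sub>2 in at_left 1. signed_measure_of {1..n} (M x\<^sub>2) (X x\<^sub>2) {{1..k}} < 0))"
    if k: "k \<in> {3..n}" for k
  proof -
    have "3 \<le> k" using k by simp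
    show ?thesis
      unfolding polylog_eq[OF \<open>3 \<le> k\<close>]
    proof (intro conjI impI)
      assume "- poly (logistic_poly (k - 1)) \<alpha>\<^sub>2 < 0"
      then show "\<forall>\<^sub>F x\<^sub>2 in at_left 1. signed_measure_of {1..n} (M x\<^sub>2) (X x\<^sub>2) {{1..k}} > 0"
        using sgn_signed[OF k] by (auto elim!: eventually_mono simp: sgn_1_pos)
    next
      assume "- poly (logistic_poly (k - 1)) \<alpha>\<^sub>2 > 0"
      then show "\<forall>\<^sub>F x\<^sub>2 in at_left 1. signed_measure_of {1..n} (M x\<^sub>2) (X x\<^sub>2) {{1..k}} < 0"
        using sgn_signed[OF k] by (auto elim!: eventually_mono simp: sgn_1_neg)
    qed
  qed

  \<comment> \<open>The threshold for representability\<close>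
  have "1 \<le> n - 1"
    using \<open>3 \<le> n\<close> by simp
  obtain a where a_mono: "strict_mono_on {..n - 1} a" and a_ends: "a 0 = 0" "a (n - 1) = 1"
    and a_roots: "{x. poly (logistic_poly (n - 1)) x = (0::real)} = a ` {..n - 1}"
    and pos: "\<And>x. 0 < x \<Longrightarrow> x < a 1 \<Longrightarrow> poly (logistic_poly (n - 1)) x > 0"
    and nonneg: "\<And>j x. j \<in> {1..n - 1} \<Longrightarrow> x \<in> {0..a 1} \<Longrightarrow> poly (logistic_poly j) x \<ge> 0"
    and neg: "\<And>x. a 1 < x \<Longrightarrow> x < 1 \<Longrightarrow> \<exists>j\<in>{2..n - 1}. poly (logistic_poly j) x < 0"
    using logistic_poly_roots[OF \<open>1 \<le> n - 1\<close>] by (elim exE conjE) (rule that, blast+)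
  \<comment> \<open>Since n - 1 \<ge> 2, index 1 lies strictly between the outer indices, so
    \<open>a 1\<close> is a root strictly inside (0, 1).\<close>
  have a1: "0 < a 1" "a 1 < 1"
    using strict_mono_onD[OF a_mono, of 0 1] strict_mono_onD[OF a_mono, of 1 "n - 1"] a_ends \<open>3 \<le> n\<close>
    by auto
  have "a 1 \<in> a ` {..n - 1}"
    using \<open>3 \<le> n\<close> by (intro imageI) auto
  then have root: "poly (logistic_poly (n - 1)) (a 1) = 0"
    unfolding a_roots[symmetric] by simp
  have "largest_negative_root n = - a 1 / (1 - a 1)"
    using largest_negative_root_eq[of "a 1" "n - 1"] a1 root pos \<open>3 \<le> n\<close> by simp
  then have "1 - largest_negative_root n = 1 / (1 - a 1)"
    using a1 by (simp add: field_simps)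
  then have "1 / (1 - largest_negative_root n) = 1 - a 1"
    by simp
  \<comment> \<open>With \<open>r = - s / (1 - s)\<close> one has
    \<open>1 / (1 - r) = 1 - s\<close>, so the bound on \<open>\<alpha>\<^sub>1\<close> says that
    \<open>\<alpha>\<^sub>2\<close> does not exceed the smallest positive root s.\<close>
  then have threshold: "\<alpha>\<^sub>1 \<ge> 1 / (1 - largest_negative_root n) \<longleftrightarrow> \<alpha>\<^sub>2 \<le> a 1"
    using \<alpha> by auto
  have b: "\<alpha>\<^sub>1 \<ge> 1 / (1 - largest_negative_root n) \<longleftrightarrow>
      (\<forall>\<^sub>F x\<^sub>2 in at_left 1. process_law (M x\<^sub>2) {1..n} (X x\<^sub>2) \<in> poisson_representable_laws {1..n})"
    unfolding threshold
  proof
    assume le: "\<alpha>\<^sub>2 \<le> a 1"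
    have "mass \<alpha>\<^sub>2 q x n k \<ge> 0" if "0 < x \<and> x < 1" "k \<in> {1..n}" for x k
    proof -
      \<comment> \<open>The case k = 1 is separate: its polynomial is the identity, while
        \<open>nonneg\<close> starts at index 1.\<close>
      have "poly (logistic_poly (k - 1)) p \<ge> 0" if "0 \<le> p" "p \<le> \<alpha>\<^sub>2" for p
        using nonneg[of "k - 1" p] diff_le_mono[of k n 1] that le \<open>k \<in> {1..n}\<close> by (cases "k = 1") (auto simp: Suc_le_eq)
      then show ?thesis
        using that \<alpha> q by (intro mass_nonneg) auto
    qed
    note mass = this
    show "\<forall>\<^sub>F x in at_left 1. process_law (M x) {1..n} (X x) \<in> poisson_representable_laws {1..n}"
      using near by (rule eventually_mono) (use rep mass in blast)
  next
    assume ev: "\<forall>\<^sub>F x in at_left 1. process_law (M x) {1..n} (X x) \<in> poisson_representable_laws {1..n}"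
    show "\<alpha>\<^sub>2 \<le> a 1"
    proof (rule ccontr)
      assume "\<not> \<alpha>\<^sub>2 \<le> a 1"
      then obtain j where j: "j \<in> {2..n - 1}" "poly (logistic_poly j) \<alpha>\<^sub>2 < 0"
        using neg[of \<alpha>\<^sub>2] \<alpha> by auto
      \<comment> \<open>A negative polynomial of index j makes the mass of size
        \<open>j + 1 \<le> n\<close> negative near 1, against representability there.\<close>
      have "\<forall>\<^sub>F x in at_left 1. sgn (mass \<alpha>\<^sub>2 q x n (Suc j)) = sgn (poly (logistic_poly (Suc j - 1)) \<alpha>\<^sub>2)"
        using j \<alpha> by (intro eventually_sgn_mass) auto
      with ev near have "\<forall>\<^sub>F x in at_left (1::real). False"
      proof eventually_elim
        case (elim x)
        then have "mass \<alpha>\<^sub>2 q x n (Suc j) \<ge> 0"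
          using rep j by auto
        moreover have "sgn (mass \<alpha>\<^sub>2 q x n (Suc j)) = - 1"
          using elim j by simp
        ultimately show ?case
          by (simp add: sgn_1_neg)
      qed
      then show False
        by (simp add: eventually_False)
    qed
  qed
  show ?thesis
    using a b by blast
qed

end
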